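(* For every integer $n\ge 3$, ${}_n\mathrm{MPH}^{*}\subsetneq{}_n\mathrm{MVPH}$; that is, ${}_n\mathrm{MPH}^{*}$ is contained in ${}_n\mathrm{MVPH}$ and the inclusion is strict.
   Context: Let $\mathbb{R}_+^n=[0,\infty)^n$, $\langle s,x\rangle=\sum_j s_jx_j$, $\mathbf 1$ the all-ones column vector, and $\Delta(v)$ the diagonal matrix with diagonal $v$. Membership of a random vector in a class means membership of its law. A transient subgenerator is a matrix $T\in\mathbb{R}^{m\times m}$ with $T_{ii}<0$, $T_{ij}\ge0$ for $i\ne j$, row sums $T\mathbf 1\le0$ componentwise, and such that the associated continuous-time Markov chain is transient, i.e. absorption is almost sure from every state (equivalently, $T$ is invertible, equivalently all its eigenvalues have strictly negative real part). $\mathrm{PH}$ (univariate phase-type): a non-negative random variable $Z$ is in $\mathrm{PH}$ if there exist $m\ge1$, a transient subgenerator $T\in\mathbb{R}^{m\times m}$ and a row vector $\alpha\ge0$ with $\alpha\mathbf 1\le1$ such that $\mathbb{E}[e^{-sZ}]=p_0+\alpha(sI_m-T)^{-1}\mathbf t$ with $\mathbf t=-T\mathbf 1$ and $p_0=1-\alpha\mathbf 1$ (an atom at zero is allowed). ${}_n\mathrm{MPH}^{*}$: random vectors $X$ in $\mathbb{R}_+^n$ for which there exist $m\ge1$, a row vector $\alpha\in\mathbb{R}_+^{1\times m}$ with $\alpha\mathbf 1\le1$, a transient subgenerator $T\in\mathbb{R}^{m\times m}$, and an entrywise non-negative reward matrix $K\in\mathbb{R}_+^{m\times n}$ such that $\mathbb{E}[e^{-\langle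 s,X\rangle}]=p_0+\alpha(-T+\Delta(Ks))^{-1}\mathbf t$, where $\mathbf t=-T\mathbf 1$ and $p_0=1-\alpha\mathbf 1$. ${}_n\mathrm{MVPH}$: random vectors $X$ in $\mathbb{R}_+^n$ such that $\langle a,X\rangle\in\mathrm{PH}$ for every $a\in\mathbb{R}_+^n\setminus\{0\}$. *)

theory Defs
  imports "HOL-Probability.Probability" "Jordan_Normal_Form.Gauss_Jordan_Elimination"
begin

(* Both HOL-Analysis and Jordan_Normal_Form use $ and \<bullet>.  Here $ and \<bullet> are the
   component and inner product on real ^ 'n; Jordan_Normal_Form vectors (whose dimension is an
   ordinary nat, as needed for the existentially quantified order m) get the notations below. *)
no_notation Matrix.vec_index (infixl \<open>$\<close> 100)
notation Matrix.vec_index (infixl \<open>$v\<close> 100)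
no_notation Matrix.scalar_prod (infix \<open>\<bullet>\<close> 70)
notation Matrix.scalar_prod (infix \<open>\<bullet>v\<close> 70)

definition ones_vec :: "nat \<Rightarrow> real Matrix.vec" where
  "ones_vec m = Matrix.vec m (\<lambda>_. 1)"

definition mat_exp :: "real Matrix.mat \<Rightarrow> real Matrix.mat" where
  "mat_exp A = Matrix.mat (dim_row A) (dim_row A)
     (\<lambda>(i, j). \<Sum>k. (A ^\<^sub>m k) $$ (i, j) / fact k)"

(* The chain generated by T on the states {0..<m}, killed at rates -T 1, has transition
   semigroup exp(t T).  So entry i of exp(t T) 1 is the probability that the chain started in i
   has not been absorbed by time t, and absorption is almost sure iff it tends to 0. *)
definition transient_subgenerator :: "nat \<Rightarrow> real Matrix.mat \<Rightarrow> bool" where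
  "transient_subgenerator m T \<longleftrightarrow>
     T \<in> carrier_mat m m \<and>
     (\<forall>i<m. T $$ (i, i) < 0) \<and>
     (\<forall>i<m. \<forall>j<m. i \<noteq> j \<longrightarrow> 0 \<le> T $$ (i, j)) \<and>
     (\<forall>i<m. (T *\<^sub>v ones_vec m) $v i \<le> 0) \<and>
     (\<forall>i<m. ((\<lambda>t. (mat_exp (t \<cdot>\<^sub>m T) *\<^sub>v ones_vec m) $v i) \<longlongrightarrow> 0) at_top)"

definition subprobability_vec :: "nat \<Rightarrow> real Matrix.vec \<Rightarrow> bool" where
  "subprobability_vec m \<alpha> \<longleftrightarrow>
     \<alpha> \<in> carrier_vec m \<and> (\<forall>i<m. 0 \<le> \<alpha> $v i) \<and> \<alpha> \<bullet>v ones_vec m \<le> 1"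

definition exit_vec :: "nat \<Rightarrow> real Matrix.mat \<Rightarrow> real Matrix.vec" where
  "exit_vec m T = - (T *\<^sub>v ones_vec m)"

(* Only applied to invertible matrices: s I - T and -T + Delta(K s) are invertible for a
   transient subgenerator T and s \<ge> 0, K \<ge> 0. *)
definition mat_inv :: "real Matrix.mat \<Rightarrow> real Matrix.mat" where
  "mat_inv A = the (mat_inverse A)"

definition nonneg_orthant :: "(real ^ 'n) set" where
  "nonneg_orthant = {x. \<forall>i. 0 \<le> x $ i}"

(* The classes are sets of laws; a random vector belongs to a class iff its law does. *)
definition PH :: "real measure set" where
  "PH = {\<mu>. prob_space \<mu> \<and> sets \<mu> = sets borel \<and> (AE z in \<mu>. 0 \<le> z) \<and>
     (\<exists>m T \<alpha>. 1 \<le> m \<and> transient_subgenerator m T \<and> subprobability_vec m \<alpha> \<and>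
       (\<forall>s\<ge>0. (\<integral>z. exp (- (s * z)) \<partial>\<mu>) =
          (1 - \<alpha> \<bullet>v ones_vec m) +
          \<alpha> \<bullet>v (mat_inv (s \<cdot>\<^sub>m 1\<^sub>m m - T) *\<^sub>v exit_vec m T)))}"

(* K i is row i of the m x n reward matrix, so K i \<bullet> s is entry i of K s. *)
definition MPH_star :: "(real ^ 'n) measure set" where
  "MPH_star = {\<mu>. prob_space \<mu> \<and> sets \<mu> = sets borel \<and> (AE x in \<mu>. x \<in> nonneg_orthant) \<and>
     (\<exists>m \<alpha> T (K :: nat \<Rightarrow> real ^ 'n).
       1 \<le> m \<and> subprobability_vec m \<alpha> \<and> transient_subgenerator m T \<and>
       (\<forall>i<m. K i \<in> nonneg_orthant) \<and>
       (\<forall>s\<in>nonneg_orthant. (\<integral>x. exp (- (s \<bullet> x)) \<partial>\<mu>) =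
          (1 - \<alpha> \<bullet>v ones_vec m) +
          \<alpha> \<bullet>v (mat_inv (- T + mat_diag m (\<lambda>i. K i \<bullet> s)) *\<^sub>v exit_vec m T)))}"

definition MVPH :: "(real ^ 'n) measure set" where
  "MVPH = {\<mu>. prob_space \<mu> \<and> sets \<mu> = sets borel \<and> (AE x in \<mu>. x \<in> nonneg_orthant) \<and>
     (\<forall>a\<in>nonneg_orthant - {0}. distr \<mu> borel (\<lambda>x. a \<bullet> x) \<in> PH)}"

end

theory Submission
  imports Defs "Jordan_Normal_Form.Determinant"
begin

text \<open>
Inclusion. If \<open>X\<close> has the transform \<open>p\<^sub>0 + \<alpha> (- T + \<Delta>(K s))\<inverse> t\<close>, then the projection \<open>a \<bullet> X\<close> has a
transform of the same form in which \<open>K s\<close> is replaced by \<open>s w\<close> with the scalar rewards \<open>w = K a\<close>.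
States with \<open>w i = 0\<close> are invisible and can be cut out of the chain one at a time (\<open>reward_rep_eliminate\<close>); running the clock of every other state
at speed \<open>w i\<close> turns the remaining rewards into elapsed time. To see that the new chain is again
transient, almost sure absorption is first shown to be equivalent to the existence of a positive vector
\<open>y\<close> with \<open>T y < 0\<close> (\<open>transient_subgenerator_iff\<close>), a condition that survives these operations.

Strictness. Heuristically, a reward vector is a random non-negative combination of finitely many vectors
\<open>K i\<close>, so its support is a finite union of polyhedral cones, whereas in dimension at least three a
vector with phase-type projections may fill a circular cone. The example is a linear image of a
\<open>2 \<times> 2\<close> Wishart matrix, with the transform \<open>1 / ((1 + s\<^sub>1 + s\<^sub>3) (1 + s\<^sub>2 + s\<^sub>3) - s\<^sub>3\<^sup>2)\<close>
(\<open>exists_quadric_law\<close>). The denominator is \<open>det (I + M(s))\<close> with \<open>M(s)\<close> positive semidefinite for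
\<open>s \<ge> 0\<close>, so along each ray it splits into two linear factors and all projections are sums of two
independent exponential variables, possibly of mean \<open>0\<close> (\<open>quadric_factors\<close>, \<open>hypoexponential_reward_rep\<close>).

The support argument is carried out on transforms. After the states with zero reward are eliminated,
the transform of a reward vector along the ray through \<open>s\<close> has an expansion in \<open>1 / u\<close>, and if the
terms of order \<open>0\<close> and \<open>1\<close> vanish, then the coefficient of \<open>1 / u\<^sup>2\<close> is a finite sum of terms
\<open>c i j / ((K i \<bullet> s) (K j \<bullet> s))\<close> (\<open>reward_transform_second_order\<close>). For the example this coefficient is
\<open>1 / (s\<^sub>1 s\<^sub>2 + s\<^sub>1 s\<^sub>3 + s\<^sub>2 s\<^sub>3)\<close>, whose poles form an irreducible quadric instead of a union of
hyperplanes (\<open>quadric_transform_no_reward_rep\<close>).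
\<close>

section \<open>Transience as the existence of a strict supersolution\<close>

text \<open>Almost sure absorption is used in the form: some positive vector \<open>y\<close> satisfies \<open>T y < 0\<close>
componentwise. Unlike the decay of \<open>exp (t T) \<one>\<close> this form is purely algebraic, so it can be followed
through the elimination of a state, through a scaling of the rows and through a renumbering of the
states. The index set is arbitrary because states are going to be removed from it.\<close>
definition transient_on :: "'a set \<Rightarrow> ('a \<Rightarrow> 'a \<Rightarrow> real) \<Rightarrow> bool" where
  "transient_on I T \<longleftrightarrow>
     (\<forall>i\<in>I. \<forall>j\<in>I. i \<noteq> j \<longrightarrow> 0 \<le> T i j) \<and>
     (\<forall>i\<in>I. (\<Sum>j\<in>I. T i j) \<le> 0) \<and>
     (\<exists>y. \<forall>i\<in>I. 0 < y i \<and> (\<Sum>j\<in>I. T i j * y j) < 0)"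

lemma transient_on_off_diag:
  assumes "transient_on I T" "i \<in> I" "j \<in> I" "i \<noteq> j"
  shows "0 \<le> T i j"
  using assms(1)[unfolded transient_on_def, THEN conjunct1] assms(2-4) by simp

lemma transient_on_row:
  assumes "transient_on I T" "i \<in> I"
  shows "(\<Sum>j\<in>I. T i j) \<le> 0"
  using assms(1)[unfolded transient_on_def, THEN conjunct2, THEN conjunct1] assms(2) by simp

lemma transient_on_potential:
  assumes "transient_on I T"
  obtains y where "\<forall>i\<in>I. 0 < y i \<and> (\<Sum>j\<in>I. T i j * y j) < 0"
  using assms[unfolded transient_on_def, THEN conjunct2, THEN conjunct2] by (elim exE)

text \<open>The off-diagonal part of row \<open>i\<close> contributes non-negatively to \<open>(T y) i < 0\<close>, so the diagonal
entry has to be negative.\<close>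
lemma transient_on_diag_neg:
  assumes "finite I" "transient_on I T" "i \<in> I"
  shows "T i i < 0"
proof -
  obtain y where y: "\<forall>i\<in>I. 0 < y i \<and> (\<Sum>j\<in>I. T i j * y j) < 0"
    using assms(2) by (rule transient_on_potential)
  have "(\<Sum>j\<in>I. T i j * y j) = T i i * y i + (\<Sum>j\<in>I-{i}. T i j * y j)"
    using assms(1,3) by (rule sum.remove)
  moreover have "0 \<le> (\<Sum>j\<in>I-{i}. T i j * y j)"
    using transient_on_off_diag[OF assms(2,3)] y
    by (intro sum_nonneg) (auto intro!: mult_nonneg_nonneg simp: less_imp_le)
  ultimately have "T i i * y i < 0" using y assms(3) by force
  then show ?thesis using y assms(3) by (meson mult_less_0_iff order.asym)
qed

text \<open>This is \<open>B\<^sup>k \<one>\<close>. Absorption concerns \<open>exp (t T)\<close> only through its action on \<open>\<one>\<close>, so powers of matrices can be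
replaced by this iteration on vectors.\<close>
fun power_ones :: "nat \<Rightarrow> (nat \<Rightarrow> nat \<Rightarrow> real) \<Rightarrow> nat \<Rightarrow> nat \<Rightarrow> real" where
  "power_ones m B 0 i = 1"
| "power_ones m B (Suc k) i = (\<Sum>j<m. B i j * power_ones m B k j)"

lemma pow_mat_Suc_left:
  assumes "(A :: real mat) \<in> carrier_mat m m"
  shows "A ^\<^sub>m Suc k = A * A ^\<^sub>m k"
proof (induction k)
  case 0
  show ?case using assms by simp
next
  case (Suc k)
  have "A ^\<^sub>m Suc (Suc k) = (A * A ^\<^sub>m k) * A" using Suc.IH by simp
  also have "\<dots> = A * (A ^\<^sub>m k * A)"
    using assms by (simp add: assoc_mult_mat[of _ m m _ m _ m])
  finally show ?case by simp
qed

lemma pow_mat_row_sum: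
  assumes "T \<in> carrier_mat m m" "i < m"
  shows "(\<Sum>j<m. (T ^\<^sub>m k) $$ (i, j)) = power_ones m (\<lambda>i j. T $$ (i, j)) k i"
  using assms(2)
proof (induction k arbitrary: i)
  case 0
  then show ?case using assms(1) by simp
next
  case (Suc k)
  have "(\<Sum>j<m. (T ^\<^sub>m Suc k) $$ (i, j)) = (\<Sum>j<m. \<Sum>l<m. T $$ (i, l) * (T ^\<^sub>m k) $$ (l, j))"
    unfolding pow_mat_Suc_left[OF assms(1)]
    using assms(1) Suc.prems by (simp add: scalar_prod_def atLeast0LessThan)
  also have "\<dots> = (\<Sum>l<m. T $$ (i, l) * (\<Sum>j<m. (T ^\<^sub>m k) $$ (l, j)))"
    by (subst sum.swap) (simp add: sum_distrib_left)
  also have "\<dots> = power_ones m (\<lambda>i j. T $$ (i, j)) (Suc k) i"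
    using Suc.IH by simp
  finally show ?case .
qed

text \<open>The geometric bound makes the entrywise series that defines \<open>mat_exp\<close> converge, so that its
infinite sums are genuine limits and may be rearranged.\<close>
lemma pow_mat_entry_bound:
  fixes T :: "real mat"
  assumes T: "T \<in> carrier_mat m m" and "i < m" "j < m"
  defines "c \<equiv> (\<Sum>i<m. \<Sum>j<m. \<bar>T $$ (i, j)\<bar>)"
  shows "\<bar>(T ^\<^sub>m k) $$ (i, j)\<bar> \<le> c ^ k"
  using assms(2)
proof (induction k arbitrary: i)
  case 0
  then show ?case using assms by simp
next
  case (Suc k)
  have c0: "0 \<le> c" unfolding c_def by (intro sum_nonneg) auto
  have "\<bar>(T ^\<^sub>m Suc k) $$ (i, j)\<bar> = \<bar>\<Sum>l<m. T $$ (i, l) * (T ^\<^sub>m k) $$ (l, j)\<bar>"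
    unfolding pow_mat_Suc_left[OF T]
    using T Suc.prems assms(3) by (simp add: scalar_prod_def atLeast0LessThan)
  also have "\<dots> \<le> (\<Sum>l<m. \<bar>T $$ (i, l)\<bar> * c ^ k)"
    by (rule order.trans[OF sum_abs], rule sum_mono)
      (use Suc.IH in \<open>auto simp: abs_mult intro!: mult_left_mono\<close>)
  also have "\<dots> = (\<Sum>l<m. \<bar>T $$ (i, l)\<bar>) * c ^ k" by (simp add: sum_distrib_right)
  also have "(\<Sum>l<m. \<bar>T $$ (i, l)\<bar>) \<le> c" unfolding c_def
    using Suc.prems by (intro member_le_sum[of i "{..<m}" "\<lambda>i. \<Sum>j<m. \<bar>T $$ (i, j)\<bar>"]) (auto intro: sum_nonneg)
  finally show ?case using c0 by (simp add: mult_right_mono)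
qed

lemma power_ones_scale:
  "power_ones m (\<lambda>i j. t * B i j) k i = t ^ k * power_ones m B k i"
  by (induction k arbitrary: i) (auto simp: sum_distrib_left mult_ac)

lemma mat_exp_ones_sums:
  assumes T: "T \<in> carrier_mat m m" and i: "i < m"
  shows "(\<lambda>k. t ^ k * power_ones m (\<lambda>i j. T $$ (i, j)) k i / fact k) sums
           (mat_exp (t \<cdot>\<^sub>m T) *\<^sub>v ones_vec m) $v i"
    and "summable (\<lambda>k. \<bar>t ^ k * power_ones m (\<lambda>i j. T $$ (i, j)) k i / fact k\<bar>)"
proof -
  let ?A = "t \<cdot>\<^sub>m T"
  have A: "?A \<in> carrier_mat m m" using T by simp
  define c where "c = (\<Sum>i<m. \<Sum>j<m. \<bar>?A $$ (i, j)\<bar>)"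
  have sa: "summable (\<lambda>k. \<bar>(?A ^\<^sub>m k) $$ (i, j) / fact k\<bar>)" if "j < m" for j
    by (rule summable_comparison_test[OF _ summable_exp[of c]])
      (use pow_mat_entry_bound[OF A i that] in \<open>auto simp: c_def divide_inverse abs_mult mult_ac
         intro!: exI[of _ 0] mult_left_mono\<close>)
  have eq: "(\<Sum>j<m. (?A ^\<^sub>m k) $$ (i, j) / fact k) =
      t ^ k * power_ones m (\<lambda>i j. T $$ (i, j)) k i / fact k" for k
  proof -
    have "(\<Sum>j<m. (?A ^\<^sub>m k) $$ (i, j) / fact k) = power_ones m (\<lambda>i j. ?A $$ (i, j)) k i / fact k"
      using pow_mat_row_sum[OF A i, of k] by (simp add: sum_divide_distrib[symmetric])
    also have "power_ones m (\<lambda>i j. ?A $$ (i, j)) k i = power_ones m (\<lambda>i j. t * T $$ (i, j)) k i"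
      using i by (induction k arbitrary: i) (use T in \<open>auto intro!: sum.cong\<close>)
    finally show ?thesis by (simp add: power_ones_scale)
  qed
  have "(\<lambda>k. \<Sum>j<m. (?A ^\<^sub>m k) $$ (i, j) / fact k) sums (\<Sum>j<m. \<Sum>k. (?A ^\<^sub>m k) $$ (i, j) / fact k)"
    using sa by (intro sums_sum summable_sums) (auto intro: summable_rabs_cancel)
  then show "(\<lambda>k. t ^ k * power_ones m (\<lambda>i j. T $$ (i, j)) k i / fact k) sums
           (mat_exp (t \<cdot>\<^sub>m T) *\<^sub>v ones_vec m) $v i"
    using T i by (simp add: eq mat_exp_def ones_vec_def scalar_prod_def atLeast0LessThan)
  have "summable (\<lambda>k. \<Sum>j<m. \<bar>(?A ^\<^sub>m k) $$ (i, j) / fact k\<bar>)"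
    using sa by (intro summable_sum) auto
  then show "summable (\<lambda>k. \<bar>t ^ k * power_ones m (\<lambda>i j. T $$ (i, j)) k i / fact k\<bar>)"
    by (rule summable_comparison_test[rotated])
      (auto simp: eq[symmetric] simp del: abs_divide intro!: exI[of _ 0] sum_abs)
qed

text \<open>This is the binomial theorem for the commuting operators \<open>T\<close> and \<open>l\<cdot>I\<close>, applied to \<open>\<one>\<close>.\<close>
lemma power_ones_shift:
  assumes "i < m"
  shows "power_ones m (\<lambda>i j. T i j + (if i = j then l else 0)) k i =
     (\<Sum>r\<le>k. of_nat (k choose r) * l ^ (k - r) * power_ones m T r i)"
  using assms
proof (induction k arbitrary: i)
  case 0
  then show ?case by simp
next
  case (Suc k)
  let ?B = "\<lambda>i j. T i j + (if i = j then l else 0)"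
  let ?g = "\<lambda>r. power_ones m T r i"
  have "power_ones m ?B (Suc k) i =
     (\<Sum>j<m. T i j * power_ones m ?B k j) + l * power_ones m ?B k i"
    using Suc.prems by (simp add: distrib_right sum.distrib if_distrib[of "\<lambda>x. x * _"] cong: if_cong)
  also have "(\<Sum>j<m. T i j * power_ones m ?B k j) =
      (\<Sum>j<m. \<Sum>r\<le>k. of_nat (k choose r) * l ^ (k - r) * (T i j * power_ones m T r j))"
    using Suc.IH by (simp add: sum_distrib_left mult_ac)
  also have "\<dots> = (\<Sum>r\<le>k. of_nat (k choose r) * l ^ (k - r) * ?g (Suc r))"
    by (subst sum.swap) (simp add: sum_distrib_left)
  also have "l * power_ones m ?B k i = (\<Sum>r\<le>k. of_nat (k choose r) * l ^ (Suc k - r) * ?g r)"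
    using Suc.IH[OF Suc.prems] by (simp add: sum_distrib_left Suc_diff_le mult_ac)
  also have "\<dots> = (\<Sum>r\<le>Suc k. of_nat (k choose r) * l ^ (Suc k - r) * ?g r)" by simp
  also have "\<dots> = l ^ Suc k * ?g 0 + (\<Sum>r\<le>k. of_nat (k choose Suc r) * l ^ (k - r) * ?g (Suc r))"
    by (subst sum.atMost_Suc_shift) (simp del: power_ones.simps)
  also have "(\<Sum>r\<le>k. of_nat (k choose r) * l ^ (k - r) * ?g (Suc r)) + \<dots> =
     l ^ Suc k * ?g 0 + (\<Sum>r\<le>k. of_nat (Suc k choose Suc r) * l ^ (k - r) * ?g (Suc r))"
    by (simp add: sum.distrib[symmetric] distrib_right del: power_ones.simps)
  also have "\<dots> = (\<Sum>r\<le>Suc k. of_nat (Suc k choose r) * l ^ (Suc k - r) * ?g r)"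
    by (subst sum.atMost_Suc_shift) (simp del: power_ones.simps)
  finally show ?case .
qed

text \<open>Uniformization: \<open>exp (l t) exp (t T) \<one> = exp (t (T + l I)) \<one>\<close>, obtained as a Cauchy product. For large
\<open>l\<close> the matrix \<open>T + l I\<close> is non-negative, so every term of the series on the left is non-negative and
estimates can be made term by term.\<close>
lemma mat_exp_ones_uniformization:
  assumes T: "T \<in> carrier_mat m m" and i: "i < m"
  shows "(\<lambda>k. t ^ k * power_ones m (\<lambda>i j. T $$ (i, j) + (if i = j then l else 0)) k i / fact k) sums
           (exp (l * t) * (mat_exp (t \<cdot>\<^sub>m T) *\<^sub>v ones_vec m) $v i)"
proof -
  let ?g = "\<lambda>k. power_ones m (\<lambda>i j. T $$ (i, j)) k i"
  let ?a = "\<lambda>k. t ^ k * ?g k / fact k"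
  let ?b = "\<lambda>k. (l * t) ^ k /\<^sub>R fact k"
  have a: "summable (\<lambda>k. norm (?a k))" "?a sums (mat_exp (t \<cdot>\<^sub>m T) *\<^sub>v ones_vec m) $v i"
    using mat_exp_ones_sums[OF T i] by auto
  have b: "summable (\<lambda>k. norm (?b k))" "?b sums exp (l * t)"
    using summable_norm_exp[of "l * t"] exp_converges[of "l * t"] by auto
  have "(\<lambda>k. \<Sum>r\<le>k. ?a r * ?b (k - r)) sums (suminf ?a * suminf ?b)"
    by (rule Cauchy_product_sums[OF a(1) b(1)])
  moreover have "(\<Sum>r\<le>k. ?a r * ?b (k - r)) =
      t ^ k * power_ones m (\<lambda>i j. T $$ (i, j) + (if i = j then l else 0)) k i / fact k" for k
  proof -
    have "?a r * ?b (k - r) = t ^ k * (of_nat (k choose r) * l ^ (k - r) * ?g r) / fact k"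
      if "r \<le> k" for r
    proof -
      have "t ^ k = t ^ r * t ^ (k - r)" using that by (simp add: power_add[symmetric])
      moreover have "(of_nat (k choose r) :: real) = fact k / (fact r * fact (k - r))"
        using that by (rule binomial_fact)
      ultimately show ?thesis by (simp add: power_mult_distrib divide_simps)
    qed
    then show ?thesis
      by (simp add: power_ones_shift[OF i] sum_distrib_left sum_divide_distrib)
  qed
  ultimately show ?thesis using a(2) b(2) by (simp add: sums_iff mult.commute)
qed

lemma power_ones_nonneg:
  assumes "\<And>i j. i < m \<Longrightarrow> j < m \<Longrightarrow> 0 \<le> B i j" "i < m"
  shows "0 \<le> power_ones m B k i"
  using assms(2) by (induction k arbitrary: i) (auto intro!: sum_nonneg mult_nonneg_nonneg assms(1))

lemma finite_uniform_pos:
  fixes f :: "'a \<Rightarrow> real"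
  assumes "finite I" "\<And>i. i \<in> I \<Longrightarrow> 0 < f i"
  obtains c where "0 < c" "\<And>i. i \<in> I \<Longrightarrow> c \<le> f i"
  using that[of "Min (insert 1 (f ` I))"] assms by simp

lemma sum_add_diag:
  fixes T :: "nat \<Rightarrow> nat \<Rightarrow> real"
  assumes "i < m"
  shows "(\<Sum>j<m. (T i j + (if i = j then l else 0)) * f j) = (\<Sum>j<m. T i j * f j) + l * f i"
  using assms by (simp add: distrib_right sum.distrib if_distrib[of "\<lambda>x. x * _"] cong: if_cong)

lemma add_diag_nonneg:
  fixes T :: "nat \<Rightarrow> nat \<Rightarrow> real"
  assumes "\<And>i j. i < m \<Longrightarrow> j < m \<Longrightarrow> i \<noteq> j \<Longrightarrow> 0 \<le> T i j" "(\<Sum>i<m. \<bar>T i i\<bar>) \<le> l" "i < m" "j < m"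
  shows "0 \<le> T i j + (if i = j then l else 0)"
proof (cases "i = j")
  case True
  have "\<bar>T i i\<bar> \<le> (\<Sum>i<m. \<bar>T i i\<bar>)"
    using assms(3) by (intro member_le_sum[of i "{..<m}" "\<lambda>i. \<bar>T i i\<bar>"]) auto
  then show ?thesis using True assms(2) by simp
qed (use assms in auto)

text \<open>With \<open>P = I + T / l\<close> substochastic, \<open>P\<^sup>k \<one>\<close> decreases to a limit, and uniformization shows that
\<open>exp (t T) \<one>\<close> stays above that limit. Absorption forces the limit to be \<open>0\<close>, so some \<open>P\<^sup>N \<one>\<close> is below
\<open>\<one>\<close>. The expected number of steps before absorption, cut off at \<open>N\<close>, that is \<open>y = \<Sum>k<N. P\<^sup>k \<one>\<close>, then satisfies
\<open>T y = l (P\<^sup>N \<one> - \<one>) < 0\<close> by telescoping.\<close>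
lemma decay_imp_potential:
  assumes T: "T \<in> carrier_mat m m"
    and off: "\<And>i j. i < m \<Longrightarrow> j < m \<Longrightarrow> i \<noteq> j \<Longrightarrow> 0 \<le> T $$ (i, j)"
    and row: "\<And>i. i < m \<Longrightarrow> (\<Sum>j<m. T $$ (i, j)) \<le> 0"
    and lim: "\<And>i. i < m \<Longrightarrow> ((\<lambda>t. (mat_exp (t \<cdot>\<^sub>m T) *\<^sub>v ones_vec m) $v i) \<longlongrightarrow> 0) at_top"
  shows "\<exists>y. \<forall>i<m. 0 < y i \<and> (\<Sum>j<m. T $$ (i, j) * y j) < 0"
proof -
  define l where "l = 1 + (\<Sum>i<m. \<bar>T $$ (i, i)\<bar>)"
  have l: "0 < l" unfolding l_def by (intro add_pos_nonneg sum_nonneg) auto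
  define B where "B = (\<lambda>i j. T $$ (i, j) + (if i = j then l else 0))"
  define p where "p = (\<lambda>k i. power_ones m B k i / l ^ k)"
  have B0: "0 \<le> B i j" if "i < m" "j < m" for i j
    unfolding B_def using that off by (intro add_diag_nonneg[of m "\<lambda>i j. T $$ (i, j)"]) (auto simp: l_def)
  have Bs: "(\<Sum>j<m. B i j * f j) = (\<Sum>j<m. T $$ (i, j) * f j) + l * f i" if "i < m" for f i
    unfolding B_def using that by (rule sum_add_diag)
  have p0: "0 \<le> p k i" if "i < m" for k i
    using power_ones_nonneg[OF B0 that] l by (simp add: p_def)
  \<comment> \<open>This is \<open>T = l (P - I)\<close> applied to \<open>P\<^sup>k \<one>\<close>; it makes the sum defining the supersolution telescope.\<close>
  have pT: "(\<Sum>j<m. T $$ (i, j) * p k j) = l * (p (Suc k) i - p k i)" if "i < m" for k i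
  proof -
    have "(\<Sum>j<m. B i j * p k j) = l * p (Suc k) i"
      using l by (simp add: p_def sum_divide_distrib[symmetric])
    then show ?thesis using Bs[OF that, of "p k"] by (simp add: algebra_simps)
  qed
  have dec: "p (Suc k) i \<le> p k i" if "i < m" for k i
    using that
  proof (induction k arbitrary: i)
    case 0
    have "(\<Sum>j<m. T $$ (i, j) * p 0 j) \<le> 0" using row[OF 0] by (simp add: p_def)
    then show ?case using pT[OF 0, of 0] l by (simp add: mult_le_0_iff)
  next
    case (Suc k)
    have "p (Suc (Suc k)) i = (\<Sum>j<m. B i j * p (Suc k) j) / l"
      using l by (simp add: p_def sum_divide_distrib[symmetric])
    also have "\<dots> \<le> (\<Sum>j<m. B i j * p k j) / l"
      using l Suc B0 by (intro divide_right_mono sum_mono mult_left_mono) auto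
    also have "\<dots> = p (Suc k) i" using l by (simp add: p_def sum_divide_distrib[symmetric])
    finally show ?case .
  qed
  have plim: "(\<lambda>k. p k i) \<longlonglongrightarrow> 0" if i: "i < m" for i
  proof -
    have "decseq (\<lambda>k. p k i)" using dec[OF i] by (intro decseq_SucI) auto
    then obtain q where q: "(\<lambda>k. p k i) \<longlonglongrightarrow> q" "\<And>k. q \<le> p k i"
      using decseq_convergent[of "\<lambda>k. p k i" 0] p0[OF i] by blast
    have "q \<le> (mat_exp (t \<cdot>\<^sub>m T) *\<^sub>v ones_vec m) $v i" if t: "0 \<le> t" for t
    proof -
      have "(\<lambda>k. q * ((l * t) ^ k /\<^sub>R fact k)) sums (q * exp (l * t))"
        by (intro sums_mult exp_converges)
      moreover have "(\<lambda>k. t ^ k * power_ones m B k i / fact k) sums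
           (exp (l * t) * (mat_exp (t \<cdot>\<^sub>m T) *\<^sub>v ones_vec m) $v i)"
        unfolding B_def by (rule mat_exp_ones_uniformization[OF T i])
      moreover have "q * ((l * t) ^ k /\<^sub>R fact k) \<le> t ^ k * power_ones m B k i / fact k" for k
      proof -
        have "q * l ^ k \<le> power_ones m B k i"
          using q(2)[of k] l by (simp add: p_def field_simps)
        then have "t ^ k * (q * l ^ k) / fact k \<le> t ^ k * power_ones m B k i / fact k"
          using t by (intro divide_right_mono mult_left_mono) auto
        then show ?thesis by (simp add: power_mult_distrib divide_inverse mult_ac)
      qed
      ultimately have "q * exp (l * t) \<le> exp (l * t) * (mat_exp (t \<cdot>\<^sub>m T) *\<^sub>v ones_vec m) $v i"
        by (rule sums_le[rotated])
      then show ?thesis by (simp add: mult.commute)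
    qed
    then have "\<forall>\<^sub>F t in at_top. q \<le> (mat_exp (t \<cdot>\<^sub>m T) *\<^sub>v ones_vec m) $v i"
      by (intro eventually_at_top_linorderI[of 0])
    then have "q \<le> 0" using lim[OF i] by (intro tendsto_lowerbound) auto
    moreover have "0 \<le> q" using q(1) p0[OF i] by (intro LIMSEQ_le_const) auto
    ultimately show ?thesis using q(1) by simp
  qed
  have "\<forall>i\<in>{..<m}. \<forall>\<^sub>F k in sequentially. p k i < 1"
    using plim by (auto intro!: order_tendstoD(2))
  then have "\<forall>\<^sub>F k in sequentially. \<forall>i\<in>{..<m}. p k i < 1"
    by (intro eventually_ball_finite) auto
  then obtain N where N: "\<And>i. i < m \<Longrightarrow> p N i < 1"
    by (auto simp: eventually_sequentially)
  have "0 < (\<Sum>k<N. p k i) \<and> (\<Sum>j<m. T $$ (i, j) * (\<Sum>k<N. p k j)) < 0" if i: "i < m" for i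
  proof
    \<comment> \<open>The vector \<open>p 0 = \<one>\<close> is not below \<open>\<one>\<close>.\<close>
    have "N \<noteq> 0" using N[OF i] by (intro notI) (simp add: p_def)
    then show "0 < (\<Sum>k<N. p k i)"
      using p0[OF i] by (intro sum_pos2[of _ 0]) (auto simp: p_def)
    have "(\<Sum>j<m. T $$ (i, j) * (\<Sum>k<N. p k j)) = (\<Sum>k<N. l * (p (Suc k) i - p k i))"
      by (simp add: sum_distrib_left sum.swap[of _ "{..<m}"] pT[OF i, symmetric])
    also have "\<dots> = l * (p N i - p 0 i)"
      using sum_lessThan_telescope[of "\<lambda>k. p k i" N] by (simp add: sum_distrib_left[symmetric])
    also have "\<dots> < 0" using l N[OF i] by (simp add: p_def mult_less_0_iff)
    finally show "(\<Sum>j<m. T $$ (i, j) * (\<Sum>k<N. p k j)) < 0" .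
  qed
  then show ?thesis by (intro exI[of _ "\<lambda>i. \<Sum>k<N. p k i"]) auto
qed

text \<open>From \<open>T y \<le> - c y\<close> with \<open>c > 0\<close> the non-negative matrix \<open>B = T + l I\<close> satisfies \<open>B y \<le> (l - c) y\<close>.
Hence \<open>B\<^sup>k \<one>\<close> is at most a multiple of \<open>(l - c)\<^sup>k y\<close>, and uniformization gives decay at rate
\<open>exp (- c t)\<close>.\<close>
lemma potential_imp_decay:
  assumes T: "T \<in> carrier_mat m m"
    and off: "\<And>i j. i < m \<Longrightarrow> j < m \<Longrightarrow> i \<noteq> j \<Longrightarrow> 0 \<le> T $$ (i, j)"
    and y: "\<And>i. i < m \<Longrightarrow> 0 < y i" "\<And>i. i < m \<Longrightarrow> (\<Sum>j<m. T $$ (i, j) * y j) < 0"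
    and i: "i < m"
  shows "((\<lambda>t. (mat_exp (t \<cdot>\<^sub>m T) *\<^sub>v ones_vec m) $v i) \<longlongrightarrow> 0) at_top"
proof -
  obtain c where c: "0 < c" "\<And>i. i < m \<Longrightarrow> c \<le> - (\<Sum>j<m. T $$ (i, j) * y j) / y i"
    using finite_uniform_pos[of "{..<m}" "\<lambda>i. - (\<Sum>j<m. T $$ (i, j) * y j) / y i"] y
    by (auto simp: divide_neg_pos)
  \<comment> \<open>The constant \<open>e\<close> allows the comparison \<open>e \<one> \<le> y\<close>.\<close>
  obtain e where e: "0 < e" "\<And>i. i < m \<Longrightarrow> e \<le> y i"
    using finite_uniform_pos[of "{..<m}" y] y by auto
  define l where "l = c + (\<Sum>i<m. \<bar>T $$ (i, i)\<bar>)"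
  have l: "c \<le> l" unfolding l_def by (simp add: sum_nonneg)
  define B where "B = (\<lambda>i j. T $$ (i, j) + (if i = j then l else 0))"
  have B0: "0 \<le> B i j" if "i < m" "j < m" for i j
    unfolding B_def using that off c(1)
    by (intro add_diag_nonneg[of m "\<lambda>i j. T $$ (i, j)"]) (auto simp: l_def)
  have bound: "e * power_ones m B k i \<le> (l - c) ^ k * y i" if "i < m" for k i
    using that
  proof (induction k arbitrary: i)
    case 0
    then show ?case using e by simp
  next
    case (Suc k)
    have "e * power_ones m B (Suc k) i = (\<Sum>j<m. B i j * (e * power_ones m B k j))"
      by (simp add: sum_distrib_left mult_ac)
    also have "\<dots> \<le> (\<Sum>j<m. B i j * ((l - c) ^ k * y j))"
      using Suc B0 by (intro sum_mono mult_left_mono) auto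
    also have "\<dots> = (l - c) ^ k * (\<Sum>j<m. B i j * y j)"
      by (simp add: sum_distrib_left mult_ac)
    also have "(\<Sum>j<m. B i j * y j) = (\<Sum>j<m. T $$ (i, j) * y j) + l * y i"
      unfolding B_def using Suc.prems by (rule sum_add_diag)
    also have "(l - c) ^ k * \<dots> \<le> (l - c) ^ k * ((l - c) * y i)"
      using c(2)[OF Suc.prems] y(1)[OF Suc.prems] l by (intro mult_left_mono) (auto simp: field_simps)
    finally show ?case by (simp add: mult_ac)
  qed
  have unif: "(\<lambda>k. t ^ k * power_ones m B k i / fact k) sums
      (exp (l * t) * (mat_exp (t \<cdot>\<^sub>m T) *\<^sub>v ones_vec m) $v i)" for t
    unfolding B_def by (rule mat_exp_ones_uniformization[OF T i])
  have nonneg: "0 \<le> (mat_exp (t \<cdot>\<^sub>m T) *\<^sub>v ones_vec m) $v i" if t: "0 \<le> t" for t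
  proof -
    have "0 \<le> exp (l * t) * (mat_exp (t \<cdot>\<^sub>m T) *\<^sub>v ones_vec m) $v i"
      by (rule sums_le[OF _ sums_zero unif]) (use t power_ones_nonneg[OF B0 i] in auto)
    then show ?thesis by (simp add: zero_le_mult_iff)
  qed
  have le: "(mat_exp (t \<cdot>\<^sub>m T) *\<^sub>v ones_vec m) $v i \<le> y i / e * exp (- c * t)" if t: "0 \<le> t" for t
  proof -
    have "exp (l * t) * (mat_exp (t \<cdot>\<^sub>m T) *\<^sub>v ones_vec m) $v i \<le> y i / e * exp ((l - c) * t)"
    proof (rule sums_le[OF _ unif sums_mult[OF exp_converges]])
      fix k
      have "t ^ k * power_ones m B k i \<le> t ^ k * ((l - c) ^ k * y i / e)"
        using bound[OF i, of k] e(1) t by (intro mult_left_mono) (auto simp: field_simps)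
      then have "t ^ k * power_ones m B k i / fact k \<le> t ^ k * ((l - c) ^ k * y i / e) / fact k"
        by (rule divide_right_mono) simp
      then show "t ^ k * power_ones m B k i / fact k \<le> y i / e * (((l - c) * t) ^ k /\<^sub>R fact k)"
        by (simp add: power_mult_distrib divide_inverse mult_ac)
    qed
    also have "\<dots> = exp (l * t) * (y i / e * exp (- c * t))"
      by (simp add: exp_add[symmetric] algebra_simps)
    finally show ?thesis by (rule mult_left_le_imp_le) simp
  qed
  have "((\<lambda>t. exp (- c * t)) \<longlongrightarrow> 0) at_top"
    using c(1) by (auto intro!: filterlim_compose[OF exp_at_bot]
        simp: filterlim_uminus_at_bot filterlim_tendsto_pos_mult_at_top[OF tendsto_const] filterlim_ident)
  then have "((\<lambda>t. y i / e * exp (- c * t)) \<longlongrightarrow> 0) at_top"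
    by (rule tendsto_mult_right_zero)
  note upper = this
  show ?thesis
    by (rule tendsto_sandwich[OF _ _ tendsto_const upper])
      (rule eventually_at_top_linorderI[of 0], erule nonneg le)+
qed

lemma transient_subgenerator_iff:
  assumes T: "T \<in> carrier_mat m m"
  shows "transient_subgenerator m T \<longleftrightarrow> transient_on {..<m} (\<lambda>i j. T $$ (i, j))"
proof -
  have row: "(T *\<^sub>v ones_vec m) $v i = (\<Sum>j<m. T $$ (i, j))" if "i < m" for i
    using T that by (simp add: ones_vec_def scalar_prod_def atLeast0LessThan)
  show ?thesis
  proof
    assume *: "transient_subgenerator m T"
    then have "\<exists>y. \<forall>i<m. 0 < y i \<and> (\<Sum>j<m. T $$ (i, j) * y j) < 0"
      unfolding transient_subgenerator_def using row by (intro decay_imp_potential[OF T]) auto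
    then show "transient_on {..<m} (\<lambda>i j. T $$ (i, j))"
      using * row unfolding transient_on_def transient_subgenerator_def by auto
  next
    assume *: "transient_on {..<m} (\<lambda>i j. T $$ (i, j))"
    then obtain y where y: "\<forall>i\<in>{..<m}. 0 < y i \<and> (\<Sum>j<m. T $$ (i, j) * y j) < 0"
      by (rule transient_on_potential)
    have off: "0 \<le> T $$ (i, j)" if "i < m" "j < m" "i \<noteq> j" for i j
      using * that unfolding transient_on_def by simp
    have "((\<lambda>t. (mat_exp (t \<cdot>\<^sub>m T) *\<^sub>v ones_vec m) $v i) \<longlongrightarrow> 0) at_top" if "i < m" for i
      using y that by (intro potential_imp_decay[OF T off, of y]) auto
    then show "transient_subgenerator m T"
      using T row * transient_on_diag_neg[OF _ *]
      unfolding transient_on_def transient_subgenerator_def by simp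
  qed
qed

section \<open>Transforms as solutions of linear equations\<close>

text \<open>The vector \<open>x = (- T + \<Delta>(v))\<inverse> t\<close> is described by the linear system that it solves, which avoids
inverses of matrices whose size changes. Its entry \<open>x i\<close> is the expectation of
\<open>exp (- \<integral> v)\<close> along the chain started in \<open>i\<close> and run until absorption.\<close>
definition discount_eq :: "'a set \<Rightarrow> ('a \<Rightarrow> 'a \<Rightarrow> real) \<Rightarrow> ('a \<Rightarrow> real) \<Rightarrow> ('a \<Rightarrow> real) \<Rightarrow> bool" where
  "discount_eq I T v x \<longleftrightarrow>
     (\<forall>i\<in>I. v i * x i - (\<Sum>j\<in>I. T i j * x j) = - (\<Sum>j\<in>I. T i j))"

text \<open>\<open>L s\<close> is the transform \<open>p\<^sub>0 + \<alpha> (- T + \<Delta>(v s))\<inverse> t\<close> for all parameters \<open>s\<close> in \<open>S\<close>. Both classes of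
laws are instances: \<open>v s i = s\<close> for phase-type laws and \<open>v s i = (K s) i\<close> for the reward construction.\<close>
definition reward_rep ::
  "'a set \<Rightarrow> ('a \<Rightarrow> real) \<Rightarrow> ('a \<Rightarrow> 'a \<Rightarrow> real) \<Rightarrow> 's set \<Rightarrow> ('s \<Rightarrow> 'a \<Rightarrow> real) \<Rightarrow> ('s \<Rightarrow> real) \<Rightarrow> bool" where
  "reward_rep I \<alpha> T S v L \<longleftrightarrow>
     (\<forall>i\<in>I. 0 \<le> \<alpha> i) \<and> sum \<alpha> I \<le> 1 \<and> transient_on I T \<and>
     (\<forall>s\<in>S. \<exists>x. discount_eq I T (v s) x \<and> L s = 1 - sum \<alpha> I + (\<Sum>i\<in>I. \<alpha> i * x i))"

text \<open>A maximum principle for \<open>- T + \<Delta>(v)\<close>: at a state where \<open>\<bar>x i\<bar> / y i\<close> is maximal, the strict inequality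
\<open>(T y) i < 0\<close> makes the diagonal term outweigh all the others, unless \<open>x\<close> vanishes.\<close>
lemma transient_on_injective:
  assumes fin: "finite I" and T: "transient_on I T" and v: "\<And>i. i \<in> I \<Longrightarrow> 0 \<le> v i"
    and eq: "\<And>i. i \<in> I \<Longrightarrow> v i * x i = (\<Sum>j\<in>I. T i j * x j)"
    and k: "k \<in> I"
  shows "x k = 0"
proof (rule ccontr)
  assume xk: "x k \<noteq> 0"
  obtain y where y: "\<forall>i\<in>I. 0 < y i \<and> (\<Sum>j\<in>I. T i j * y j) < 0"
    using T by (rule transient_on_potential)
  define r where "r = Max ((\<lambda>i. \<bar>x i\<bar> / y i) ` I)"
  have "r \<in> (\<lambda>i. \<bar>x i\<bar> / y i) ` I" unfolding r_def using fin k by (intro Max_in) auto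
  then obtain i where i: "i \<in> I" "r = \<bar>x i\<bar> / y i" by blast
  have le: "\<bar>x j\<bar> \<le> r * y j" if "j \<in> I" for j
  proof -
    have "\<bar>x j\<bar> / y j \<le> r" unfolding r_def using fin that by (intro Max_ge) auto
    then show ?thesis using y that by (simp add: pos_divide_le_eq)
  qed
  have r: "0 < r"
    using le[OF k] xk y k by (smt (verit) mult_nonpos_nonneg)
  have ri: "r * y i = \<bar>x i\<bar>" using i y by (auto simp: field_simps)
  have off: "0 \<le> T i j" if "j \<in> I - {i}" for j
    using transient_on_off_diag[OF T i(1)] that by auto
  have "(v i - T i i) * x i = (\<Sum>j\<in>I-{i}. T i j * x j)"
    using eq[OF i(1)] sum.remove[OF fin i(1), of "\<lambda>j. T i j * x j"] by (simp add: algebra_simps)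
  then have "(v i - T i i) * \<bar>x i\<bar> = \<bar>\<Sum>j\<in>I-{i}. T i j * x j\<bar>"
    using v[OF i(1)] transient_on_diag_neg[OF fin T i(1)] by (metis abs_mult abs_of_nonneg diff_ge_0_iff_ge dual_order.trans less_imp_le)
  also have "\<dots> \<le> (\<Sum>j\<in>I-{i}. T i j * (r * y j))"
    by (rule order.trans[OF sum_abs], rule sum_mono)
      (use off le in \<open>auto simp: abs_mult intro!: mult_mono\<close>)
  also have "\<dots> = r * (\<Sum>j\<in>I. T i j * y j) - T i i * (r * y i)"
    using sum.remove[OF fin i(1), of "\<lambda>j. T i j * y j"]
    by (simp add: sum_distrib_left algebra_simps)
  also have "\<dots> < - T i i * \<bar>x i\<bar>"
    using r y i(1) unfolding ri by (simp add: mult_pos_neg)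
  finally have "v i * \<bar>x i\<bar> < 0" by (simp add: algebra_simps)
  then show False using v[OF i(1)] by (simp add: mult_less_0_iff)
qed

lemma discount_eq_iff_mat_inv:
  assumes ts: "transient_subgenerator m T" and v: "\<And>i. i < m \<Longrightarrow> 0 \<le> v i"
  shows "dim_vec (mat_inv (- T + mat_diag m v) *\<^sub>v exit_vec m T) = m"
    and "discount_eq {..<m} (\<lambda>i j. T $$ (i, j)) v x \<longleftrightarrow>
    (\<forall>i<m. x i = (mat_inv (- T + mat_diag m v) *\<^sub>v exit_vec m T) $v i)"
proof -
  have T: "T \<in> carrier_mat m m" using ts unfolding transient_subgenerator_def by simp
  have to: "transient_on {..<m} (\<lambda>i j. T $$ (i, j))" using ts transient_subgenerator_iff[OF T] by simp
  define M where "M = - T + mat_diag m v"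
  have M: "M \<in> carrier_mat m m" unfolding M_def using T by simp
  have t: "exit_vec m T \<in> carrier_vec m" "\<And>i. i < m \<Longrightarrow> exit_vec m T $v i = - (\<Sum>j<m. T $$ (i, j))"
    using T by (auto simp: exit_vec_def ones_vec_def scalar_prod_def atLeast0LessThan)
  have Mx: "(M *\<^sub>v u) $v i = v i * u $v i - (\<Sum>j<m. T $$ (i, j) * u $v j)"
    if "i < m" "u \<in> carrier_vec m" for i u
  proof -
    have "(M *\<^sub>v u) $v i = (\<Sum>j<m. (- T $$ (i, j) + (if i = j then v i else 0)) * u $v j)"
      using that M T by (auto simp: M_def mat_diag_def scalar_prod_def atLeast0LessThan intro!: sum.cong)
    also have "\<dots> = (\<Sum>j<m. - T $$ (i, j) * u $v j) + v i * u $v i"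
      using sum_add_diag[OF that(1), of "\<lambda>i j. - T $$ (i, j)" "v i" "\<lambda>j. u $v j"] by simp
    finally show ?thesis by (simp add: sum_negf)
  qed
  have "det M \<noteq> 0"
  proof
    assume "det M = 0"
    then obtain u where u: "u \<in> carrier_vec m" "u \<noteq> 0\<^sub>v m" "M *\<^sub>v u = 0\<^sub>v m"
      using det_0_iff_vec_prod_zero_field[OF M] by blast
    have "u $v i = 0" if "i < m" for i
    proof (rule transient_on_injective[OF _ to, of v "\<lambda>i. u $v i"])
      show "v j * u $v j = (\<Sum>l<m. T $$ (j, l) * u $v l)" if "j \<in> {..<m}" for j
        using Mx[of j u] u that by simp
    qed (use v that in auto)
    then have "u = 0\<^sub>v m" using u(1) by auto
    then show False using u(2) by simp
  qed
  then have "M \<in> Units (ring_mat TYPE(real) m ())"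
    by (rule det_non_zero_imp_unit[OF M])
  then obtain N where "mat_inverse M = Some N"
    using mat_inverse(1)[OF M, of "()"] by (cases "mat_inverse M") auto
  then have N: "mat_inv M = N" "M * N = 1\<^sub>m m" "N * M = 1\<^sub>m m" "N \<in> carrier_mat m m"
    using mat_inverse(2)[OF M] by (auto simp: mat_inv_def)
  have sol: "discount_eq {..<m} (\<lambda>i j. T $$ (i, j)) v x \<longleftrightarrow> M *\<^sub>v Matrix.vec m x = exit_vec m T"
  proof -
    have "discount_eq {..<m} (\<lambda>i j. T $$ (i, j)) v x \<longleftrightarrow>
        (\<forall>i<m. (M *\<^sub>v Matrix.vec m x) $v i = exit_vec m T $v i)"
      unfolding discount_eq_def using Mx[of _ "Matrix.vec m x"] t(2) by auto
    also have "\<dots> \<longleftrightarrow> M *\<^sub>v Matrix.vec m x = exit_vec m T"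
      using M t(1) by (auto simp: Matrix.vec_eq_iff simp del: index_mult_mat_vec)
    finally show ?thesis .
  qed
  also have "\<dots> \<longleftrightarrow> Matrix.vec m x = N *\<^sub>v exit_vec m T"
  proof
    assume *: "M *\<^sub>v Matrix.vec m x = exit_vec m T"
    have "N *\<^sub>v (M *\<^sub>v Matrix.vec m x) = (N * M) *\<^sub>v Matrix.vec m x"
      using M N(4) by (simp add: assoc_mult_mat_vec[of _ m m _ m])
    then show "Matrix.vec m x = N *\<^sub>v exit_vec m T" using N(3) * by simp
  next
    assume *: "Matrix.vec m x = N *\<^sub>v exit_vec m T"
    have "M *\<^sub>v (N *\<^sub>v exit_vec m T) = (M * N) *\<^sub>v exit_vec m T"
      using M N(4) t(1) by (simp add: assoc_mult_mat_vec[of _ m m _ m])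
    then show "M *\<^sub>v Matrix.vec m x = exit_vec m T" using N(2) * t(1) by simp
  qed
  also have "\<dots> \<longleftrightarrow> (\<forall>i<m. x i = (N *\<^sub>v exit_vec m T) $v i)"
    using N(4) t(1) by (auto simp: Matrix.vec_eq_iff)
  finally show "discount_eq {..<m} (\<lambda>i j. T $$ (i, j)) v x \<longleftrightarrow>
    (\<forall>i<m. x i = (mat_inv (- T + mat_diag m v) *\<^sub>v exit_vec m T) $v i)"
    unfolding N(1)[symmetric] M_def .
  show "dim_vec (mat_inv (- T + mat_diag m v) *\<^sub>v exit_vec m T) = m"
    using N(1,4) unfolding M_def by simp
qed

lemma reward_rep_of_matrix:
  assumes ts: "transient_subgenerator m T" and \<alpha>: "subprobability_vec m \<alpha>"
    and v: "\<And>s i. s \<in> S \<Longrightarrow> i < m \<Longrightarrow> 0 \<le> v s i"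
  shows "reward_rep {..<m} (\<lambda>i. \<alpha> $v i) (\<lambda>i j. T $$ (i, j)) S v L \<longleftrightarrow>
    (\<forall>s\<in>S. L s = (1 - \<alpha> \<bullet>v ones_vec m) +
       \<alpha> \<bullet>v (mat_inv (- T + mat_diag m (v s)) *\<^sub>v exit_vec m T))"
proof -
  have T: "T \<in> carrier_mat m m" using ts unfolding transient_subgenerator_def by simp
  let ?u = "\<lambda>s. mat_inv (- T + mat_diag m (v s)) *\<^sub>v exit_vec m T"
  have a1: "\<alpha> \<bullet>v ones_vec m = (\<Sum>i<m. \<alpha> $v i)"
    by (simp add: ones_vec_def scalar_prod_def atLeast0LessThan)
  have iff: "(\<exists>x. discount_eq {..<m} (\<lambda>i j. T $$ (i, j)) (v s) x \<and>
         L s = 1 - (\<Sum>i<m. \<alpha> $v i) + (\<Sum>i<m. \<alpha> $v i * x i)) \<longleftrightarrow>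
       L s = (1 - \<alpha> \<bullet>v ones_vec m) + \<alpha> \<bullet>v ?u s" if s: "s \<in> S" for s
  proof -
    have dim: "dim_vec (?u s) = m"
      by (rule discount_eq_iff_mat_inv(1)[OF ts]) (use v s in auto)
    have de: "discount_eq {..<m} (\<lambda>i j. T $$ (i, j)) (v s) x \<longleftrightarrow> (\<forall>i<m. x i = ?u s $v i)" for x
      by (rule discount_eq_iff_mat_inv(2)[OF ts]) (use v s in auto)
    have "\<alpha> \<bullet>v ?u s = (\<Sum>i<m. \<alpha> $v i * ?u s $v i)"
      unfolding scalar_prod_def dim atLeast0LessThan ..
    then show ?thesis unfolding de a1 by (auto intro!: exI[of _ "\<lambda>i. ?u s $v i"])
  qed
  have "(\<forall>i\<in>{..<m}. 0 \<le> \<alpha> $v i) \<and> (\<Sum>i<m. \<alpha> $v i) \<le> 1"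
    using \<alpha> unfolding subprobability_vec_def a1 by auto
  then show ?thesis
    unfolding reward_rep_def using ts transient_subgenerator_iff[OF T] iff by auto
qed

section \<open>Eliminating states without reward\<close>

text \<open>Time spent in a state \<open>z\<close> with reward \<open>0\<close> is not seen by the transform, so \<open>z\<close> can be skipped: every
jump into \<open>z\<close> is redirected to the state reached on leaving \<open>z\<close> (a Schur complement of \<open>- T\<close>). On the
level of equations this solves equation \<open>z\<close> for \<open>x z\<close> and substitutes the result into the others. The
same vector \<open>y\<close> witnesses transience of the reduced chain.\<close>
lemma reward_rep_eliminate:
  assumes fin: "finite I" and z: "z \<in> I" and rep: "reward_rep I \<alpha> T S v L"
    and vz: "\<And>s. s \<in> S \<Longrightarrow> v s z = 0"
  shows "\<exists>\<alpha>' T'. reward_rep (I - {z}) \<alpha>' T' S v L"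
proof -
  let ?J = "I - {z}"
  have T: "transient_on I T" and \<alpha>: "\<And>i. i \<in> I \<Longrightarrow> 0 \<le> \<alpha> i" "sum \<alpha> I \<le> 1"
    and sol: "\<And>s. s \<in> S \<Longrightarrow> \<exists>x. discount_eq I T (v s) x \<and> L s = 1 - sum \<alpha> I + (\<Sum>i\<in>I. \<alpha> i * x i)"
    using rep unfolding reward_rep_def by auto
  define c where "c = - T z z"
  have c: "0 < c" using transient_on_diag_neg[OF fin T z] by (simp add: c_def)
  define T' where "T' = (\<lambda>i j. T i j + T i z * T z j / c)"
  define \<alpha>' where "\<alpha>' = (\<lambda>j. \<alpha> j + \<alpha> z * T z j / c)"
  obtain y where "\<forall>i\<in>I. 0 < y i \<and> (\<Sum>j\<in>I. T i j * y j) < 0"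
    using T by (rule transient_on_potential)
  then have y: "\<And>i. i \<in> I \<Longrightarrow> 0 < y i" "\<And>i. i \<in> I \<Longrightarrow> (\<Sum>j\<in>I. T i j * y j) < 0"
    by auto
  note off = transient_on_off_diag[OF T] and row = transient_on_row[OF T]
  note rem = sum.remove[OF fin z]
  have T'sum: "(\<Sum>j\<in>?J. T' i j * f j) = (\<Sum>j\<in>?J. T i j * f j) + T i z * ((\<Sum>j\<in>?J. T z j * f j) / c)" for i f
    by (simp add: T'_def ring_distribs sum.distrib sum_distrib_left sum_divide_distrib mult_ac)
  have \<alpha>'sum: "(\<Sum>j\<in>?J. \<alpha>' j * f j) = (\<Sum>j\<in>?J. \<alpha> j * f j) + \<alpha> z * ((\<Sum>j\<in>?J. T z j * f j) / c)" for f
    by (simp add: \<alpha>'_def ring_distribs sum.distrib sum_distrib_left sum_divide_distrib mult_ac)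
  have zrow: "(\<Sum>j\<in>?J. T z j) / c \<le> 1"
  proof -
    have "(\<Sum>j\<in>?J. T z j) \<le> c" using row[OF z] rem[of "T z"] by (simp add: c_def)
    then show ?thesis using c by simp
  qed
  have trans: "transient_on ?J T'"
    unfolding transient_on_def
  proof (intro conjI ballI impI exI[of _ y])
    fix i j assume "i \<in> ?J" "j \<in> ?J" "i \<noteq> j"
    then show "0 \<le> T' i j" unfolding T'_def using off z c by (auto intro!: add_nonneg_nonneg divide_nonneg_pos mult_nonneg_nonneg)
  next
    fix i assume i: "i \<in> ?J"
    have "T i z * ((\<Sum>j\<in>?J. T z j) / c) \<le> T i z * 1"
      using zrow off[of i z] i z by (intro mult_left_mono) auto
    then show "(\<Sum>j\<in>?J. T' i j) \<le> 0"
      using T'sum[of i "\<lambda>_. 1"] row[of i] i rem[of "T i"] by simp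
    show "0 < y i" using i y by simp
    have "(\<Sum>j\<in>?J. T z j * y j) \<le> c * y z"
      using y(2)[OF z] rem[of "\<lambda>j. T z j * y j"] by (simp add: c_def)
    then have "(\<Sum>j\<in>?J. T z j * y j) / c \<le> y z"
      using c by (simp add: pos_divide_le_eq mult.commute)
    then have "T i z * ((\<Sum>j\<in>?J. T z j * y j) / c) \<le> T i z * y z"
      using off[of i z] i z by (intro mult_left_mono) auto
    then show "(\<Sum>j\<in>?J. T' i j * y j) < 0"
      using T'sum[of i y] y(2)[of i] i rem[of "\<lambda>j. T i j * y j"] by simp
  qed
  have nonneg: "0 \<le> \<alpha>' i" if "i \<in> ?J" for i
    unfolding \<alpha>'_def using that \<alpha>(1) z c off by (auto intro!: add_nonneg_nonneg divide_nonneg_pos mult_nonneg_nonneg)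
  have "\<alpha> z * ((\<Sum>j\<in>?J. T z j) / c) \<le> \<alpha> z * 1"
    using zrow \<alpha>(1)[OF z] by (rule mult_left_mono)
  then have le1: "sum \<alpha>' ?J \<le> 1" using \<alpha>'sum[of "\<lambda>_. 1"] \<alpha>(2) rem[of \<alpha>] by simp
  have "\<exists>x. discount_eq ?J T' (v s) x \<and> L s = 1 - sum \<alpha>' ?J + (\<Sum>i\<in>?J. \<alpha>' i * x i)" if s: "s \<in> S" for s
  proof -
    obtain x where x: "discount_eq I T (v s) x" "L s = 1 - sum \<alpha> I + (\<Sum>i\<in>I. \<alpha> i * x i)"
      using sol[OF s] by blast
    have "(\<Sum>j\<in>I. T z j * x j) = (\<Sum>j\<in>I. T z j)"
      using x(1) z vz[OF s] unfolding discount_eq_def by force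
    then have "(\<Sum>j\<in>?J. T z j * x j) = c * x z - c + (\<Sum>j\<in>?J. T z j)"
      using rem[of "T z"] rem[of "\<lambda>j. T z j * x j"] by (simp add: c_def)
    then have xz: "(\<Sum>j\<in>?J. T z j * x j) / c = x z - 1 + (\<Sum>j\<in>?J. T z j) / c"
      using c by (simp add: field_simps)
    have "discount_eq ?J T' (v s) x"
      unfolding discount_eq_def
    proof
      fix i assume i: "i \<in> ?J"
      have "v s i * x i - (\<Sum>j\<in>I. T i j * x j) = - (\<Sum>j\<in>I. T i j)"
        using x(1) i unfolding discount_eq_def by blast
      then show "v s i * x i - (\<Sum>j\<in>?J. T' i j * x j) = - (\<Sum>j\<in>?J. T' i j)"
        using T'sum[of i x] T'sum[of i "\<lambda>_. 1"] rem[of "T i"] rem[of "\<lambda>j. T i j * x j"]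
        unfolding xz by (simp add: algebra_simps)
    qed
    moreover have "L s = 1 - sum \<alpha>' ?J + (\<Sum>i\<in>?J. \<alpha>' i * x i)"
      using x(2) \<alpha>'sum[of x] \<alpha>'sum[of "\<lambda>_. 1"] rem[of \<alpha>] rem[of "\<lambda>j. \<alpha> j * x j"]
      unfolding xz by (simp add: algebra_simps)
    ultimately show ?thesis by blast
  qed
  then have "reward_rep ?J \<alpha>' T' S v L"
    unfolding reward_rep_def using nonneg le1 trans by blast
  then show ?thesis by blast
qed

lemma reward_rep_eliminate_all:
  assumes "finite I" and "reward_rep I \<alpha> T S v L"
  shows "\<exists>\<alpha>' T'. reward_rep {i\<in>I. \<exists>s\<in>S. v s i \<noteq> 0} \<alpha>' T' S v L"
proof -
  have "\<exists>\<alpha>' T'. reward_rep (I - Z) \<alpha>' T' S v L"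
    if "finite Z" "Z \<subseteq> {i\<in>I. \<forall>s\<in>S. v s i = 0}" for Z
    using that
  proof (induction Z rule: finite_induct)
    case empty
    then show ?case using assms(2) by auto
  next
    case (insert z Z)
    then obtain \<alpha>' T' where "reward_rep (I - Z) \<alpha>' T' S v L" by auto
    then have "\<exists>\<alpha>' T'. reward_rep (I - Z - {z}) \<alpha>' T' S v L"
      using insert assms(1) by (intro reward_rep_eliminate) auto
    then show ?case by (simp add: Diff_insert2[symmetric] Diff_insert[symmetric])
  qed
  moreover have "I - {i\<in>I. \<forall>s\<in>S. v s i = 0} = {i\<in>I. \<exists>s\<in>S. v s i \<noteq> 0}" by auto
  ultimately show ?thesis using assms(1) by (metis (no_types, lifting) finite_subset mem_Collect_eq subsetI)
qed

text \<open>Changing the speed of the clock in state \<open>i\<close> turns the reward \<open>w i\<close> into \<open>1\<close>.\<close>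
lemma reward_rep_scale:
  assumes w: "\<And>i. i \<in> I \<Longrightarrow> 0 < w i" and rep: "reward_rep I \<alpha> T S v L"
  shows "reward_rep I \<alpha> (\<lambda>i j. T i j / w i) S (\<lambda>s i. v s i / w i) L"
proof -
  have "(\<Sum>j\<in>I. T i j / w i * f j) = (\<Sum>j\<in>I. T i j * f j) / w i" for i f
    by (simp add: sum_divide_distrib)
  note s = this this[of _ "\<lambda>_. 1", simplified]
  have "transient_on I (\<lambda>i j. T i j / w i)"
    using rep w unfolding reward_rep_def transient_on_def s
    by (auto simp: divide_nonneg_pos divide_nonpos_pos intro!: divide_neg_pos)
  moreover have "discount_eq I (\<lambda>i j. T i j / w i) (\<lambda>i. v s i / w i) x" if "discount_eq I T (v s) x" for s x
    unfolding discount_eq_def s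
  proof
    fix i assume i: "i \<in> I"
    have "(v s i * x i - (\<Sum>j\<in>I. T i j * x j)) / w i = - (\<Sum>j\<in>I. T i j) / w i"
      using that i unfolding discount_eq_def by auto
    then show "v s i / w i * x i - (\<Sum>j\<in>I. T i j * x j) / w i = - ((\<Sum>j\<in>I. T i j) / w i)"
      by (simp add: diff_divide_distrib)
  qed
  ultimately show ?thesis using rep unfolding reward_rep_def by blast
qed

lemma reward_rep_reindex:
  assumes f: "bij_betw f J I" and rep: "reward_rep I \<alpha> T S v L"
  shows "reward_rep J (\<lambda>i. \<alpha> (f i)) (\<lambda>i j. T (f i) (f j)) S (\<lambda>s i. v s (f i)) L"
proof -
  have r: "(\<Sum>j\<in>J. g (f j)) = sum g I" for g :: "_ \<Rightarrow> real" by (rule sum.reindex_bij_betw[OF f])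
  have fI: "f i \<in> I" if "i \<in> J" for i using f that by (auto simp: bij_betw_def)
  have inj: "f i = f j \<longleftrightarrow> i = j" if "i \<in> J" "j \<in> J" for i j
    using f that by (auto simp: bij_betw_def inj_on_def)
  have "transient_on J (\<lambda>i j. T (f i) (f j))"
  proof -
    obtain y where y: "\<forall>i\<in>I. 0 < y i \<and> (\<Sum>j\<in>I. T i j * y j) < 0"
      using rep[unfolded reward_rep_def, THEN conjunct2, THEN conjunct2, THEN conjunct1] by (rule transient_on_potential)
    have "\<forall>i\<in>J. 0 < y (f i) \<and> (\<Sum>j\<in>J. T (f i) (f j) * y (f j)) < 0"
      using y fI by (simp add: r[of "\<lambda>j. T _ j * y j"])
    then show ?thesis
      using rep fI inj unfolding reward_rep_def transient_on_def r by (intro conjI exI[of _ "\<lambda>i. y (f i)"]) auto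
  qed
  moreover have "discount_eq J (\<lambda>i j. T (f i) (f j)) (\<lambda>i. v s (f i)) (\<lambda>i. x (f i))"
    if "discount_eq I T (v s) x" for s x
    using that fI unfolding discount_eq_def by (simp add: r r[of "\<lambda>j. T _ j * x j"])
  ultimately show ?thesis
    using rep fI unfolding reward_rep_def r by (fastforce simp: r[of "\<lambda>j. \<alpha> j * _ j"])
qed

section \<open>Projections of reward vectors\<close>

text \<open>If no state is left, then \<open>L\<close> is constantly \<open>1\<close> and the law is the point mass at \<open>0\<close>. A representation
of positive order is obtained by adding a state in which the chain never starts.\<close>
lemma reward_rep_one_state_of_empty:
  fixes v :: "'s \<Rightarrow> nat \<Rightarrow> real"
  assumes rep: "reward_rep {} \<alpha> T S (w :: 's \<Rightarrow> 'a \<Rightarrow> real) L" and v: "\<And>s. s \<in> S \<Longrightarrow> 0 \<le> v s 0"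
  shows "reward_rep {..<1} (\<lambda>_. 0) (\<lambda>_ _. - 1) S v L"
proof -
  have "transient_on {..<1::nat} (\<lambda>_ _. - 1)"
    unfolding transient_on_def by (auto intro!: exI[of _ "\<lambda>_. 1"])
  moreover have "discount_eq {..<1::nat} (\<lambda>_ _. - 1) (v s) (\<lambda>_. 1 / (v s 0 + 1))" if "s \<in> S" for s
    using v[OF that] by (simp add: discount_eq_def field_simps)
  ultimately show ?thesis using rep unfolding reward_rep_def by fastforce
qed

text \<open>This is the passage from rewards \<open>w\<close> to phase-type form: remove the states with \<open>w i = 0\<close>, rescale
time in the others to make all rewards \<open>1\<close>, and number the remaining states.\<close>
lemma PH_of_reward_rep:
  assumes \<mu>: "prob_space \<mu>" "sets \<mu> = sets borel" "AE z in \<mu>. 0 \<le> z"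
    and fin: "finite (I :: 'a set)" and w: "\<And>i. i \<in> I \<Longrightarrow> 0 \<le> w i"
    and rep: "reward_rep I \<alpha> T {0..} (\<lambda>s i. s * w i) (\<lambda>s. \<integral>z. exp (- (s * z)) \<partial>\<mu>)"
  shows "\<mu> \<in> PH"
proof -
  let ?L = "\<lambda>s. \<integral>z. exp (- (s * z)) \<partial>\<mu>"
  define J where "J = {i \<in> I. \<exists>s\<in>{0..}. s * w i \<noteq> 0}"
  have finJ: "finite J" using fin by (simp add: J_def)
  have wJ: "0 < w i" if "i \<in> J" for i using that w[of i] by (auto simp: J_def less_le)
  obtain \<alpha>1 T1 where r1: "reward_rep J \<alpha>1 T1 {0..} (\<lambda>s i. s * w i) ?L"
    using reward_rep_eliminate_all[OF fin rep] unfolding J_def by blast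
  have "\<exists>m \<beta> U. 1 \<le> m \<and> reward_rep {..<m::nat} \<beta> U {0..} (\<lambda>s _. s) ?L"
  proof (cases "J = {}")
    case True
    show ?thesis
      by (rule exI[of _ 1]) (use reward_rep_one_state_of_empty[of \<alpha>1 T1 "{0..}" _ ?L "\<lambda>s _. s"] r1 True in auto)
  next
    case False
    obtain f where f: "bij_betw f {..<card J} J"
      using ex_bij_betw_nat_finite[OF finJ] unfolding atLeast0LessThan by blast
    have "reward_rep {..<card J} (\<lambda>i. \<alpha>1 (f i)) (\<lambda>i j. T1 (f i) (f j) / w (f i)) {0..}
        (\<lambda>s i. s * w (f i) / w (f i)) ?L"
      by (rule reward_rep_reindex[OF f reward_rep_scale[OF wJ r1]])
    moreover have "discount_eq {..<card J} U (\<lambda>i. s * w (f i) / w (f i)) x \<longleftrightarrow> discount_eq {..<card J} U (\<lambda>_. s) x" for U s x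
    proof -
      have "w (f i) \<noteq> 0" if "i < card J" for i
        using wJ[of "f i"] bij_betwE[OF f] that by fastforce
      then show ?thesis by (simp add: discount_eq_def)
    qed
    ultimately have "reward_rep {..<card J} (\<lambda>i. \<alpha>1 (f i)) (\<lambda>i j. T1 (f i) (f j) / w (f i)) {0..} (\<lambda>s _. s) ?L"
      unfolding reward_rep_def by simp
    moreover have "1 \<le> card J" using False finJ by (simp add: Suc_le_eq card_gt_0_iff)
    ultimately show ?thesis by blast
  qed
  then obtain m :: nat and \<beta> U where m: "1 \<le> m" and r: "reward_rep {..<m} \<beta> U {0..} (\<lambda>s _. s) ?L"
    by blast
  define b where "b = Matrix.vec m \<beta>"
  define M where "M = Matrix.mat m m (\<lambda>(i, j). U i j)"
  have M: "M \<in> carrier_mat m m" by (simp add: M_def)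
  have Mr: "reward_rep {..<m} (\<lambda>i. b $v i) (\<lambda>i j. M $$ (i, j)) {0..} (\<lambda>s _. s) ?L"
    using r unfolding reward_rep_def transient_on_def discount_eq_def by (simp add: b_def M_def)
  have ts: "transient_subgenerator m M"
    using Mr transient_subgenerator_iff[OF M] unfolding reward_rep_def by simp
  have sp: "subprobability_vec m b"
    using Mr unfolding reward_rep_def subprobability_vec_def
    by (simp add: b_def ones_vec_def scalar_prod_def atLeast0LessThan)
  have "\<forall>s\<in>{0..}. ?L s = (1 - b \<bullet>v ones_vec m) +
       b \<bullet>v (mat_inv (- M + mat_diag m (\<lambda>_. s)) *\<^sub>v exit_vec m M)"
    using Mr by (subst (asm) reward_rep_of_matrix[OF ts sp]) auto
  moreover have "- M + mat_diag m (\<lambda>_. s) = s \<cdot>\<^sub>m 1\<^sub>m m - M" for s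
    using M by (intro eq_matI) (auto simp: mat_diag_def)
  ultimately show ?thesis
    unfolding PH_def using \<mu> m ts sp by auto
qed

lemma inner_nonneg_orthant:
  assumes "b \<in> nonneg_orthant" "c \<in> nonneg_orthant"
  shows "0 \<le> b \<bullet> (c :: real ^ ('n::finite))"
  using assms by (auto simp: nonneg_orthant_def inner_vec_def intro!: sum_nonneg)

text \<open>Projecting to the direction \<open>a\<close> replaces the reward vectors \<open>K i\<close> by the scalar rewards \<open>K i \<bullet> a\<close>.\<close>
lemma MPH_star_subset_MVPH: "(MPH_star :: (real ^ 'n) measure set) \<subseteq> MVPH"
proof
  fix \<mu> :: "(real ^ 'n) measure"
  assume "\<mu> \<in> MPH_star"
  then obtain m \<alpha> T and K :: "nat \<Rightarrow> real ^ 'n" where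
    \<mu>: "prob_space \<mu>" "sets \<mu> = sets borel" "AE x in \<mu>. x \<in> nonneg_orthant"
    and \<alpha>: "subprobability_vec m \<alpha>" and T: "transient_subgenerator m T"
    and K: "\<forall>i<m. K i \<in> nonneg_orthant"
    and L: "\<forall>s\<in>nonneg_orthant. (\<integral>x. exp (- (s \<bullet> x)) \<partial>\<mu>) =
          (1 - \<alpha> \<bullet>v ones_vec m) +
          \<alpha> \<bullet>v (mat_inv (- T + mat_diag m (\<lambda>i. K i \<bullet> s)) *\<^sub>v exit_vec m T)"
    unfolding MPH_star_def by blast
  have "distr \<mu> borel (\<lambda>x. a \<bullet> x) \<in> PH" if a: "a \<in> nonneg_orthant - {0}" for a
  proof -
    have meas: "(\<lambda>x. a \<bullet> x) \<in> borel_measurable \<mu>"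
      using \<mu>(2) by (simp cong: measurable_cong_sets)
    note dot = inner_nonneg_orthant[where 'n = 'n]
    have sa: "s *\<^sub>R a \<in> nonneg_orthant" if "s \<in> {0..}" for s
      using that a by (simp add: nonneg_orthant_def)
    have Ka: "0 \<le> K i \<bullet> a" if "i < m" for i using K that a dot by simp
    have "(\<integral>z. exp (- (s * z)) \<partial>distr \<mu> borel (\<lambda>x. a \<bullet> x)) =
       (1 - \<alpha> \<bullet>v ones_vec m) +
       \<alpha> \<bullet>v (mat_inv (- T + mat_diag m (\<lambda>i. s * (K i \<bullet> a))) *\<^sub>v exit_vec m T)" if s: "s \<in> {0..}" for s
    proof -
      have "(\<integral>z. exp (- (s * z)) \<partial>distr \<mu> borel (\<lambda>x. a \<bullet> x)) = (\<integral>x. exp (- ((s *\<^sub>R a) \<bullet> x)) \<partial>\<mu>)"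
        using meas by (subst integral_distr) auto
      then show ?thesis using bspec[OF L sa[OF s]] by simp
    qed
    then have "reward_rep {..<m} (\<lambda>i. \<alpha> $v i) (\<lambda>i j. T $$ (i, j)) {0..} (\<lambda>s i. s * (K i \<bullet> a))
       (\<lambda>s. \<integral>z. exp (- (s * z)) \<partial>distr \<mu> borel (\<lambda>x. a \<bullet> x))"
      by (subst reward_rep_of_matrix[OF T \<alpha>]) (use Ka in auto)
    moreover have "AE z in distr \<mu> borel (\<lambda>x. a \<bullet> x). 0 \<le> z"
      using \<mu>(3) dot a by (subst AE_distr_iff[OF meas]) (auto elim: eventually_mono)
    ultimately show ?thesis
      using Ka by (intro PH_of_reward_rep[of _ "{..<m}" "\<lambda>i. K i \<bullet> a"])
        (auto intro: prob_space.prob_space_distr[OF \<mu>(1) meas])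
  qed
  then show "\<mu> \<in> MVPH" unfolding MVPH_def using \<mu> by simp
qed

section \<open>A law supported by a circular cone\<close>

text \<open>The variance is \<open>1/2\<close>, so the density is \<open>exp (- x\<^sup>2) / sqrt pi\<close>, and integrating the exponential of a
negative quadratic form just adds the identity matrix to that form.\<close>
definition gauss :: "real measure" where
  "gauss = density lborel (\<lambda>x. ennreal (normal_density 0 (1 / sqrt 2) x))"

lemma prob_space_gauss: "prob_space gauss"
  unfolding gauss_def by (rule prob_space_normal_density) simp

lemma sets_gauss [measurable_cong, simp]: "sets gauss = sets borel"
  by (simp add: gauss_def)

text \<open>Completing the square turns the integrand into a multiple of another normal density.\<close>
lemma nn_integral_gauss:
  assumes p: "0 < 1 + p"
  shows "(\<integral>\<^sup>+ x. ennreal (exp (- (p * x\<^sup>2 + 2 * b * x))) \<partial>gauss) = ennreal (exp (b\<^sup>2 / (1 + p)) / sqrt (1 + p))"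
proof -
  let ?\<sigma> = "1 / sqrt (2 * (1 + p))" and ?m = "- b / (1 + p)"
  let ?c = "exp (b\<^sup>2 / (1 + p)) / sqrt (1 + p)"
  have \<sigma>: "0 < ?\<sigma>" using p by simp
  have eq: "normal_density 0 (1 / sqrt 2) x * exp (- (p * x\<^sup>2 + 2 * b * x)) = ?c * normal_density ?m ?\<sigma> x" for x
  proof -
    define w where "w = b / (1 + p)"
    have w: "b = w * (1 + p)" using p by (simp add: w_def)
    have "b\<^sup>2 / (1 + p) = w\<^sup>2 * (1 + p)" using p unfolding w by (simp add: power2_eq_square)
    then have "- (x\<^sup>2) - (p * x\<^sup>2 + 2 * b * x) = b\<^sup>2 / (1 + p) - (x + b / (1 + p))\<^sup>2 * (1 + p)"
      unfolding w_def[symmetric] by (simp add: w power2_eq_square algebra_simps)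
    then have "exp (- (x\<^sup>2)) * exp (- (p * x\<^sup>2 + 2 * b * x)) = exp (b\<^sup>2 / (1 + p)) * exp (- ((x + b / (1 + p))\<^sup>2 * (1 + p)))"
      by (simp add: exp_add[symmetric])
    moreover have "normal_density 0 (1 / sqrt 2) x = exp (- (x\<^sup>2)) / sqrt pi"
      by (simp add: normal_density_def power_divide)
    moreover have "normal_density ?m ?\<sigma> x = sqrt (1 + p) / sqrt pi * exp (- ((x + b / (1 + p))\<^sup>2 * (1 + p)))"
    proof -
      have \<sigma>2: "?\<sigma>\<^sup>2 = 1 / (2 * (1 + p))" using p by (simp add: power_divide)
      have "2 * pi * (1 / (2 * (1 + p))) = pi / (1 + p)" using p by (simp add: field_simps)
      moreover have "- (x - ?m)\<^sup>2 / (2 * (1 / (2 * (1 + p)))) = - ((x + b / (1 + p))\<^sup>2 * (1 + p))"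
        by simp
      ultimately show ?thesis unfolding normal_density_def \<sigma>2 by (simp only: real_sqrt_divide) simp
    qed
    ultimately show ?thesis using p by simp
  qed
  have "(\<integral>\<^sup>+ x. ennreal (exp (- (p * x\<^sup>2 + 2 * b * x))) \<partial>gauss) =
      (\<integral>\<^sup>+ x. ennreal (normal_density 0 (1 / sqrt 2) x) * ennreal (exp (- (p * x\<^sup>2 + 2 * b * x))) \<partial>lborel)"
    unfolding gauss_def by (rule nn_integral_density) simp_all
  also have "\<dots> = (\<integral>\<^sup>+ x. ennreal ?c * ennreal (normal_density ?m ?\<sigma> x) \<partial>lborel)"
    unfolding ennreal_mult'[OF normal_density_nonneg, symmetric] eq
    by (intro nn_integral_cong ennreal_mult') (use p in simp)
  also have "\<dots> = ennreal ?c * (\<integral>\<^sup>+ x. ennreal (normal_density ?m ?\<sigma> x) \<partial>lborel)"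
    by (rule nn_integral_cmult) simp
  also have "(\<integral>\<^sup>+ x. ennreal (normal_density ?m ?\<sigma> x) \<partial>lborel) = 1"
    using prob_space.emeasure_space_1[OF prob_space_normal_density[OF \<sigma>, of ?m]]
    by (simp add: emeasure_density)
  finally show ?thesis by simp
qed

text \<open>The one-dimensional formula is applied twice. The inner integral over the second variable replaces the
coefficient \<open>P\<close> of the first one by \<open>P - r\<^sup>2 / (1 + Q)\<close>.\<close>
lemma nn_integral_gauss_pair:
  assumes PQ: "0 \<le> P" "0 \<le> Q" "r\<^sup>2 \<le> P * Q"
  shows "(\<integral>\<^sup>+ z. ennreal (exp (- (P * (fst z)\<^sup>2 + Q * (snd z)\<^sup>2 + 2 * r * fst z * snd z))) \<partial>(gauss \<Otimes>\<^sub>M gauss))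
     = ennreal (1 / sqrt ((1 + P) * (1 + Q) - r\<^sup>2))"
proof -
  interpret prob_space gauss by (rule prob_space_gauss)
  let ?p = "P - r\<^sup>2 / (1 + Q)"
  have p: "0 < 1 + ?p"
  proof -
    have "r\<^sup>2 < (1 + P) * (1 + Q)" using PQ by (simp add: algebra_simps)
    then show ?thesis using PQ by (simp add: field_simps)
  qed
  have "(\<integral>\<^sup>+ z. ennreal (exp (- (P * (fst z)\<^sup>2 + Q * (snd z)\<^sup>2 + 2 * r * fst z * snd z))) \<partial>(gauss \<Otimes>\<^sub>M gauss))
     = (\<integral>\<^sup>+ x. \<integral>\<^sup>+ y. ennreal (exp (- (P * x\<^sup>2 + Q * y\<^sup>2 + 2 * r * x * y))) \<partial>gauss \<partial>gauss)"
    by (subst nn_integral_fst[symmetric]) simp_all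
  also have "\<dots> = (\<integral>\<^sup>+ x. ennreal (1 / sqrt (1 + Q)) * ennreal (exp (- (?p * x\<^sup>2 + 2 * 0 * x))) \<partial>gauss)"
  proof (rule nn_integral_cong)
    fix x
    have "(\<integral>\<^sup>+ y. ennreal (exp (- (P * x\<^sup>2 + Q * y\<^sup>2 + 2 * r * x * y))) \<partial>gauss) =
        (\<integral>\<^sup>+ y. ennreal (exp (- P * x\<^sup>2)) * ennreal (exp (- (Q * y\<^sup>2 + 2 * (r * x) * y))) \<partial>gauss)"
      by (intro nn_integral_cong) (simp add: ennreal_mult'[symmetric] exp_add[symmetric] algebra_simps)
    also have "\<dots> = ennreal (exp (- P * x\<^sup>2)) * (\<integral>\<^sup>+ y. ennreal (exp (- (Q * y\<^sup>2 + 2 * (r * x) * y))) \<partial>gauss)"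
      by (rule nn_integral_cmult) simp
    also have "(\<integral>\<^sup>+ y. ennreal (exp (- (Q * y\<^sup>2 + 2 * (r * x) * y))) \<partial>gauss) =
        ennreal (exp ((r * x)\<^sup>2 / (1 + Q)) / sqrt (1 + Q))"
      using PQ by (intro nn_integral_gauss) simp
    also have "ennreal (exp (- P * x\<^sup>2)) * ennreal (exp ((r * x)\<^sup>2 / (1 + Q)) / sqrt (1 + Q)) =
        ennreal (1 / sqrt (1 + Q)) * ennreal (exp (- (?p * x\<^sup>2 + 2 * 0 * x)))"
    proof -
      have "- P * x\<^sup>2 + (r * x)\<^sup>2 / (1 + Q) = - (?p * x\<^sup>2 + 2 * 0 * x)"
        by (simp add: power_mult_distrib left_diff_distrib)
      then have "exp (- P * x\<^sup>2) * exp ((r * x)\<^sup>2 / (1 + Q)) = exp (- (?p * x\<^sup>2 + 2 * 0 * x))"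
        by (simp only: exp_add[symmetric])
      then have e: "exp (- P * x\<^sup>2) * (exp ((r * x)\<^sup>2 / (1 + Q)) / sqrt (1 + Q)) = 1 / sqrt (1 + Q) * exp (- (?p * x\<^sup>2 + 2 * 0 * x))"
        by simp
      show ?thesis
        unfolding ennreal_mult'[OF exp_ge_zero, symmetric] e by (rule ennreal_mult') (use PQ in simp)
    qed
    finally show "(\<integral>\<^sup>+ y. ennreal (exp (- (P * x\<^sup>2 + Q * y\<^sup>2 + 2 * r * x * y))) \<partial>gauss) = \<dots>" .
  qed
  also have "\<dots> = ennreal (1 / sqrt (1 + Q)) * ennreal (exp (0\<^sup>2 / (1 + ?p)) / sqrt (1 + ?p))"
    using p by (subst nn_integral_cmult) (simp_all only: nn_integral_gauss, simp)
  also have "\<dots> = ennreal (1 / sqrt ((1 + Q) * (1 + ?p)))"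
    using PQ p by (simp add: ennreal_mult'[symmetric] real_sqrt_mult)
  also have "(1 + Q) * (1 + ?p) = (1 + P) * (1 + Q) - r\<^sup>2"
    using PQ by (simp add: field_simps)
  finally show ?thesis .
qed

text \<open>With independent centred normal variables \<open>x\<close>, \<open>y\<close>, \<open>x'\<close>, \<open>y'\<close> of variance \<open>1/2\<close> the law is that of the vector with entries
\<open>x\<^sup>2 + x'\<^sup>2\<close>, \<open>y\<^sup>2 + y'\<^sup>2\<close> and \<open>(x + y)\<^sup>2 + (x' + y')\<^sup>2\<close> (a linear image of a Wishart matrix), the other
entries being \<open>0\<close>. Each of the pairs \<open>(x, y)\<close> and \<open>(x', y')\<close> contributes the inverse square root of the denominator
to the transform, and taking two pairs makes the transform rational.\<close>
lemma exists_quadric_law: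
  fixes i1 i2 i3 :: "'n::finite"
  assumes dist: "i1 \<noteq> i2" "i1 \<noteq> i3" "i2 \<noteq> i3"
  shows "\<exists>\<mu> :: (real ^ 'n) measure. prob_space \<mu> \<and> sets \<mu> = sets borel \<and> (AE x in \<mu>. x \<in> nonneg_orthant) \<and>
    (\<forall>s\<in>nonneg_orthant. (\<integral>x. exp (- (s \<bullet> x)) \<partial>\<mu>) =
       1 / ((1 + s $ i1 + s $ i3) * (1 + s $ i2 + s $ i3) - (s $ i3)\<^sup>2))"
proof -
  let ?G = "gauss \<Otimes>\<^sub>M gauss"
  interpret G: prob_space ?G by (intro prob_space_pair prob_space_gauss)
  interpret G4: pair_prob_space ?G ?G ..
  define X :: "(real \<times> real) \<times> (real \<times> real) \<Rightarrow> real ^ 'n" where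
    "X = (\<lambda>z. ((fst (fst z))\<^sup>2 + (fst (snd z))\<^sup>2) *\<^sub>R axis i1 1 +
              ((snd (fst z))\<^sup>2 + (snd (snd z))\<^sup>2) *\<^sub>R axis i2 1 +
              ((fst (fst z) + snd (fst z))\<^sup>2 + (fst (snd z) + snd (snd z))\<^sup>2) *\<^sub>R axis i3 1)"
  have X [measurable]: "X \<in> borel_measurable (?G \<Otimes>\<^sub>M ?G)"
    unfolding X_def by measurable
  define \<mu> where "\<mu> = distr (?G \<Otimes>\<^sub>M ?G) borel X"
  have "prob_space \<mu>" unfolding \<mu>_def by (rule G4.prob_space_distr[OF X])
  moreover have "sets \<mu> = sets borel" by (simp add: \<mu>_def)
  moreover have "AE x in \<mu>. x \<in> nonneg_orthant"
  proof -
    have "X z \<in> nonneg_orthant" for z by (auto simp: X_def nonneg_orthant_def axis_def)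
    moreover have "{x :: real ^ 'n. x \<in> nonneg_orthant} \<in> sets borel"
      unfolding nonneg_orthant_def by measurable
    ultimately show ?thesis unfolding \<mu>_def by (subst AE_distr_iff[OF X]) auto
  qed
  moreover have "(\<integral>x. exp (- (s \<bullet> x)) \<partial>\<mu>) =
       1 / ((1 + s $ i1 + s $ i3) * (1 + s $ i2 + s $ i3) - (s $ i3)\<^sup>2)" if s: "s \<in> nonneg_orthant" for s
  proof -
    have s0: "0 \<le> s $ i" for i using s by (simp add: nonneg_orthant_def)
    let ?P = "s $ i1 + s $ i3" and ?Q = "s $ i2 + s $ i3" and ?r = "s $ i3"
    define h where "h = (\<lambda>z. exp (- (?P * (fst z)\<^sup>2 + ?Q * (snd z)\<^sup>2 + 2 * ?r * fst z * snd z)))"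
    have [measurable]: "h \<in> borel_measurable ?G" unfolding h_def by measurable
    define q where "q = (1 + ?P) * (1 + ?Q) - ?r\<^sup>2"
    have PQ: "0 \<le> ?P" "0 \<le> ?Q" "?r\<^sup>2 \<le> ?P * ?Q"
      using s0 by (auto simp: power2_eq_square intro!: mult_mono)
    have q: "0 < q" using PQ unfolding q_def by (simp add: distrib_left distrib_right)
    have hX: "exp (- (s \<bullet> X z)) = h (fst z) * h (snd z)" for z
      by (simp add: X_def h_def exp_add[symmetric] inner_add_right inner_axis power2_eq_square algebra_simps)
    have "(\<integral>x. exp (- (s \<bullet> x)) \<partial>\<mu>) = (\<integral>z. h (fst z) * h (snd z) \<partial>(?G \<Otimes>\<^sub>M ?G))"
      unfolding \<mu>_def by (subst integral_distr[OF X]) (simp_all add: hX)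
    also have "\<dots> = enn2real (\<integral>\<^sup>+ z. ennreal (h (fst z) * h (snd z)) \<partial>(?G \<Otimes>\<^sub>M ?G))"
      by (rule integral_eq_nn_integral) (auto simp: h_def)
    also have "(\<integral>\<^sup>+ z. ennreal (h (fst z) * h (snd z)) \<partial>(?G \<Otimes>\<^sub>M ?G)) =
        (\<integral>\<^sup>+ z. \<integral>\<^sup>+ w. ennreal (h z) * ennreal (h w) \<partial>?G \<partial>?G)"
      by (subst G.nn_integral_fst[symmetric]) (auto simp: h_def ennreal_mult')
    also have "\<dots> = (\<integral>\<^sup>+ z. ennreal (h z) \<partial>?G) * (\<integral>\<^sup>+ z. ennreal (h z) \<partial>?G)"
      by (simp add: nn_integral_cmult nn_integral_multc)
    also have "(\<integral>\<^sup>+ z. ennreal (h z) \<partial>?G) = ennreal (1 / sqrt q)"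
      unfolding h_def q_def by (rule nn_integral_gauss_pair[OF PQ])
    also have "enn2real (ennreal (1 / sqrt q) * ennreal (1 / sqrt q)) = 1 / q"
      using q by (simp add: ennreal_mult'[symmetric])
    finally show ?thesis by (simp add: q_def add.assoc)
  qed
  ultimately show ?thesis by blast
qed

text \<open>The chain starts in \<open>True\<close>, moves on to \<open>False\<close> and is then absorbed, all at rate \<open>1\<close>, so the reward is
the sum of two independent exponential variables with means \<open>l1\<close> and \<open>l2\<close>. A mean may be \<open>0\<close>, since
states without reward are covered by the elimination.\<close>
lemma hypoexponential_reward_rep:
  assumes l: "0 \<le> l1" "0 \<le> l2" and L: "\<And>s. 0 \<le> s \<Longrightarrow> L s = 1 / ((1 + s * l1) * (1 + s * l2))"
  shows "reward_rep (UNIV :: bool set) of_bool (\<lambda>i j. if i = j then - 1 else of_bool i) {0..}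
    (\<lambda>s i. s * (if i then l1 else l2)) L"
proof -
  have "transient_on (UNIV :: bool set) (\<lambda>i j. if i = j then - 1 else of_bool i)"
    unfolding transient_on_def
    by (intro conjI exI[of _ "\<lambda>i. if i then 2 else 1"]) (auto simp: UNIV_bool)
  moreover have "\<exists>x. discount_eq (UNIV :: bool set) (\<lambda>i j. if i = j then - 1 else of_bool i)
        (\<lambda>i. s * (if i then l1 else l2)) x \<and>
      L s = 1 - sum of_bool (UNIV :: bool set) + (\<Sum>i\<in>UNIV. of_bool i * x i)" if s: "s \<in> {0..}" for s
  proof -
    define x2 where "x2 = 1 / (1 + s * l2)"
    define x1 where "x1 = x2 / (1 + s * l1)"
    have pos: "0 < 1 + s * l1" "0 < 1 + s * l2" using s l by (auto intro: add_pos_nonneg)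
    have "(1 + s * l2) * x2 = 1" "(1 + s * l1) * x1 = x2"
      using pos by (simp_all add: x1_def x2_def)
    then have x: "x2 + s * l2 * x2 = 1" "x1 + s * l1 * x1 = x2"
      by (simp_all add: distrib_right)
    have "L s = x1" using L s by (simp add: x1_def x2_def)
    then show ?thesis
      by (intro exI[of _ "\<lambda>i. if i then x1 else x2"]) (use x in \<open>simp add: discount_eq_def UNIV_bool\<close>)
  qed
  ultimately show ?thesis unfolding reward_rep_def by (auto simp: UNIV_bool)
qed

text \<open>The left side is \<open>det (I + s M)\<close> for the symmetric positive semidefinite matrix \<open>M\<close> with rows
\<open>(a + c, c)\<close> and \<open>(c, b + c)\<close>, and \<open>l1\<close>, \<open>l2\<close> are the eigenvalues of \<open>M\<close>. The square root in the
eigenvalue formula is real because the discriminant is a sum of squares.\<close>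
lemma quadric_factors:
  fixes a b c :: real
  assumes "0 \<le> a" "0 \<le> b" "0 \<le> c"
  shows "\<exists>l1 l2. 0 \<le> l1 \<and> 0 \<le> l2 \<and>
    (\<forall>s. (1 + s * a + s * c) * (1 + s * b + s * c) - (s * c)\<^sup>2 = (1 + s * l1) * (1 + s * l2))"
proof -
  define D where "D = sqrt ((a - b)\<^sup>2 + 4 * c\<^sup>2)"
  have D2: "D\<^sup>2 = (a - b)\<^sup>2 + 4 * c\<^sup>2" by (simp add: D_def)
  have "D \<le> a + b + 2 * c"
    unfolding D_def using assms by (intro real_le_lsqrt) (auto simp: power2_eq_square algebra_simps)
  moreover have "0 \<le> D" by (simp add: D_def)
  moreover have "(1 + s * a + s * c) * (1 + s * b + s * c) - (s * c)\<^sup>2 =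
      (1 + s * ((a + b + 2 * c + D) / 2)) * (1 + s * ((a + b + 2 * c - D) / 2))" for s
  proof -
    have "(1 + s * ((a + b + 2 * c + D) / 2)) * (1 + s * ((a + b + 2 * c - D) / 2)) =
       1 + s * (a + b + 2 * c) + s\<^sup>2 * ((a + b + 2 * c)\<^sup>2 - D\<^sup>2) / 4"
      by (simp add: field_simps power2_eq_square)
    then show ?thesis unfolding D2 by (simp add: field_simps power2_eq_square)
  qed
  ultimately show ?thesis using assms
    by (intro exI[of _ "(a + b + 2 * c + D) / 2"] exI[of _ "(a + b + 2 * c - D) / 2"]) simp
qed

section \<open>The second order term at infinity\<close>

text \<open>Once every reward is positive, the solution is of order \<open>1 / u\<close> when the rewards are multiplied by
\<open>u\<close>: at a state where \<open>\<bar>x i\<bar>\<close> is maximal, equation \<open>i\<close> yields \<open>u d i \<bar>x i\<bar> \<le> t i\<close>.\<close>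
lemma discount_eq_bound:
  assumes fin: "finite I" and T: "transient_on I T" and d: "\<And>i. i \<in> I \<Longrightarrow> 0 < d i" and u: "0 < u"
    and x: "discount_eq I T (\<lambda>i. u * d i) x" and k: "k \<in> I"
  shows "\<bar>x k\<bar> \<le> (\<Sum>i\<in>I. - (\<Sum>j\<in>I. T i j) / d i) / u"
proof -
  define t where "t = (\<lambda>i. - (\<Sum>j\<in>I. T i j))"
  have t: "0 \<le> t i" if "i \<in> I" for i using transient_on_row[OF T that] by (simp add: t_def)
  obtain i where i: "i \<in> I" "\<And>j. j \<in> I \<Longrightarrow> \<bar>x j\<bar> \<le> \<bar>x i\<bar>"
    using obtains_MAX[of I "\<lambda>i. \<bar>x i\<bar>"] fin k
    by (metis (no_types, lifting) Max_ge empty_iff finite_imageI imageI)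
  note rem = sum.remove[OF fin i(1)]
  have "u * d i * x i - (\<Sum>j\<in>I. T i j * x j) = t i"
    using x i(1) unfolding discount_eq_def t_def by blast
  then have "(u * d i - T i i) * x i = t i + (\<Sum>j\<in>I-{i}. T i j * x j)"
    using rem[of "\<lambda>j. T i j * x j"] by (simp add: algebra_simps)
  then have "\<bar>u * d i - T i i\<bar> * \<bar>x i\<bar> = \<bar>t i + (\<Sum>j\<in>I-{i}. T i j * x j)\<bar>"
    by (metis abs_mult)
  also have "\<dots> \<le> \<bar>t i\<bar> + (\<Sum>j\<in>I-{i}. \<bar>T i j * x j\<bar>)"
    by (rule order.trans[OF abs_triangle_ineq]) (simp add: sum_abs)
  also have "(\<Sum>j\<in>I-{i}. \<bar>T i j * x j\<bar>) \<le> (\<Sum>j\<in>I-{i}. T i j * \<bar>x i\<bar>)"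
    using transient_on_off_diag[OF T i(1)] i(2)
    by (intro sum_mono) (auto simp: abs_mult intro!: mult_mono)
  also have "\<dots> = (- t i - T i i) * \<bar>x i\<bar>"
    using rem[of "T i"] by (simp add: t_def sum_distrib_right[symmetric])
  also have "\<bar>u * d i - T i i\<bar> = u * d i - T i i"
    using mult_pos_pos[OF u d[OF i(1)]] transient_on_diag_neg[OF fin T i(1)] by simp
  finally have "(u * d i + t i) * \<bar>x i\<bar> \<le> t i"
    using t[OF i(1)] by (simp add: algebra_simps)
  moreover have "0 \<le> t i * \<bar>x i\<bar>" using t[OF i(1)] by simp
  ultimately have "u * d i * \<bar>x i\<bar> \<le> t i" by (simp add: distrib_right)
  then have "\<bar>x i\<bar> \<le> (t i / d i) / u" using u d[OF i(1)] by (simp add: field_simps)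
  also have "\<dots> \<le> (\<Sum>i\<in>I. t i / d i) / u"
    using fin i(1) t d u by (intro divide_right_mono member_le_sum) (auto intro!: divide_nonneg_pos)
  finally show ?thesis using i(2)[OF k] by (simp add: t_def)
qed

text \<open>Write \<open>t = - T \<one>\<close>. Expanding \<open>(u \<Delta>(d) - T)\<inverse> t\<close> in powers of \<open>1 / u\<close>, the coefficients of \<open>L u\<close> of
order \<open>0\<close>, \<open>1\<close> and \<open>2\<close> are \<open>p\<close>, \<open>\<Sum>i. \<alpha> i t i / d i\<close> and the double sum below. If \<open>u\<^sup>2 L u\<close> converges,
then the first two vanish and the third is the limit. Its only denominators are products of two of the
numbers \<open>d i\<close>, which are linear forms in the application.\<close>
lemma reward_transform_second_order:
  assumes fin: "finite I" and T: "transient_on I T" and d: "\<And>i. i \<in> I \<Longrightarrow> 0 < d i"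
    and X: "\<And>u. 0 < u \<Longrightarrow> discount_eq I T (\<lambda>i. u * d i) (X u)"
    and L: "\<And>u. 0 < u \<Longrightarrow> L u = p + (\<Sum>i\<in>I. \<alpha> i * X u i)"
    and lim: "((\<lambda>u. u\<^sup>2 * L u) \<longlongrightarrow> R) at_top"
  shows "R = (\<Sum>i\<in>I. \<Sum>j\<in>I. \<alpha> i * T i j * - (\<Sum>k\<in>I. T j k) / (d i * d j))"
proof -
  define t where "t = (\<lambda>i. - (\<Sum>j\<in>I. T i j))"
  define C where "C = (\<Sum>i\<in>I. t i / d i)"
  have inv: "((\<lambda>u::real. c / u) \<longlongrightarrow> 0) at_top" for c
    by (rule tendsto_divide_0[OF tendsto_const]) (rule filterlim_at_top_imp_at_infinity[OF filterlim_ident])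
  have X0: "((\<lambda>u. X u i) \<longlongrightarrow> 0) at_top" if "i \<in> I" for i
  proof (rule Lim_null_comparison[OF _ inv])
    show "\<forall>\<^sub>F u in at_top. norm (X u i) \<le> C / u"
      using eventually_gt_at_top[of 0]
      by eventually_elim (use discount_eq_bound[OF fin T d _ X that] in \<open>simp add: C_def t_def\<close>)
  qed
  have uX_eq: "u * X u i = (t i + (\<Sum>j\<in>I. T i j * X u j)) / d i" if "0 < u" "i \<in> I" for u i
  proof -
    have "u * d i * X u i - (\<Sum>j\<in>I. T i j * X u j) = t i"
      using X[OF that(1)] that(2) unfolding discount_eq_def t_def by blast
    then show ?thesis using d[OF that(2)] by (simp add: field_simps)
  qed
  have uX: "((\<lambda>u. u * X u i) \<longlongrightarrow> t i / d i) at_top" if i: "i \<in> I" for i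
  proof -
    have "((\<lambda>u. (t i + (\<Sum>j\<in>I. T i j * X u j)) / d i) \<longlongrightarrow> (t i + (\<Sum>j\<in>I. T i j * 0)) / d i) at_top"
      by (intro tendsto_intros X0) (use d[OF i] in auto)
    then have "((\<lambda>u. (t i + (\<Sum>j\<in>I. T i j * X u j)) / d i) \<longlongrightarrow> t i / d i) at_top" by simp
    then show ?thesis
      by (rule Lim_transform_eventually) (rule eventually_mono[OF eventually_gt_at_top[of 0]], simp add: uX_eq i)
  qed
  have uL0: "((\<lambda>u. u * L u) \<longlongrightarrow> 0) at_top"
  proof -
    have "((\<lambda>u. (u\<^sup>2 * L u) * (1 / u)) \<longlongrightarrow> R * 0) at_top" by (intro tendsto_mult lim inv)
    then have "((\<lambda>u. (u\<^sup>2 * L u) * (1 / u)) \<longlongrightarrow> 0) at_top" by simp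
    then show ?thesis
      by (rule Lim_transform_eventually)
        (rule eventually_mono[OF eventually_gt_at_top[of 0]], simp add: power2_eq_square)
  qed
  have L0: "(L \<longlongrightarrow> 0) at_top"
  proof -
    have "((\<lambda>u. (u * L u) * (1 / u)) \<longlongrightarrow> 0 * 0) at_top" by (intro tendsto_mult uL0 inv)
    then have "((\<lambda>u. (u * L u) * (1 / u)) \<longlongrightarrow> 0) at_top" by simp
    then show ?thesis
      by (rule Lim_transform_eventually) (rule eventually_mono[OF eventually_gt_at_top[of 0]], simp)
  qed
  have ev: "\<forall>\<^sub>F u::real in at_top. 0 < u" by (rule eventually_gt_at_top)
  have "((\<lambda>u. p + (\<Sum>i\<in>I. \<alpha> i * X u i)) \<longlongrightarrow> p + (\<Sum>i\<in>I. \<alpha> i * 0)) at_top"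
    by (intro tendsto_intros X0) auto
  then have "((\<lambda>u. p + (\<Sum>i\<in>I. \<alpha> i * X u i)) \<longlongrightarrow> p) at_top" by simp
  then have "(L \<longlongrightarrow> p) at_top"
    by (rule Lim_transform_eventually) (rule eventually_mono[OF ev], simp add: L)
  then have p: "p = 0" using L0 by (intro tendsto_unique[of at_top L]) auto
  have "((\<lambda>u. (\<Sum>i\<in>I. \<alpha> i * (u * X u i))) \<longlongrightarrow> (\<Sum>i\<in>I. \<alpha> i * (t i / d i))) at_top"
    by (intro tendsto_intros uX) auto
  then have "((\<lambda>u. u * L u) \<longlongrightarrow> (\<Sum>i\<in>I. \<alpha> i * (t i / d i))) at_top"
    by (rule Lim_transform_eventually)
      (rule eventually_mono[OF ev], simp add: L p sum_distrib_left mult_ac)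
  then have \<alpha>t: "(\<Sum>i\<in>I. \<alpha> i * (t i / d i)) = 0" using uL0 by (intro tendsto_unique) auto
  have "((\<lambda>u. \<Sum>i\<in>I. \<alpha> i * (\<Sum>j\<in>I. T i j * (u * X u j)) / d i)
      \<longlongrightarrow> (\<Sum>i\<in>I. \<alpha> i * (\<Sum>j\<in>I. T i j * (t j / d j)) / d i)) at_top"
    by (intro tendsto_intros uX) (use d in force)+
  then have "((\<lambda>u. u\<^sup>2 * L u) \<longlongrightarrow> (\<Sum>i\<in>I. \<alpha> i * (\<Sum>j\<in>I. T i j * (t j / d j)) / d i)) at_top"
  proof (rule Lim_transform_eventually)
    show "\<forall>\<^sub>F u in at_top. (\<Sum>i\<in>I. \<alpha> i * (\<Sum>j\<in>I. T i j * (u * X u j)) / d i) = u\<^sup>2 * L u"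
      using ev
    proof eventually_elim
      case (elim u)
      have "u\<^sup>2 * (\<alpha> i * X u i) = u * (\<alpha> i * (t i / d i)) + \<alpha> i * (\<Sum>j\<in>I. T i j * (u * X u j)) / d i"
        if i: "i \<in> I" for i
      proof -
        have "u\<^sup>2 * (\<alpha> i * X u i) = u * (\<alpha> i * (u * X u i))" by (simp add: power2_eq_square)
        also have "\<dots> = u * (\<alpha> i * (t i / d i)) + \<alpha> i * (u * (\<Sum>j\<in>I. T i j * X u j)) / d i"
          unfolding uX_eq[OF elim i] by (simp add: add_divide_distrib distrib_left mult_ac)
        also have "u * (\<Sum>j\<in>I. T i j * X u j) = (\<Sum>j\<in>I. T i j * (u * X u j))"
          by (simp add: sum_distrib_left mult_ac)
        finally show ?thesis .
      qed
      then have "u\<^sup>2 * L u = u * (\<Sum>i\<in>I. \<alpha> i * (t i / d i)) +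
          (\<Sum>i\<in>I. \<alpha> i * (\<Sum>j\<in>I. T i j * (u * X u j)) / d i)"
        using L[OF elim] p by (simp add: sum_distrib_left sum.distrib)
      then show ?case unfolding \<alpha>t by simp
    qed
  qed
  then have "R = (\<Sum>i\<in>I. \<alpha> i * (\<Sum>j\<in>I. T i j * (t j / d j)) / d i)"
    using lim by (intro tendsto_unique) auto
  also have "\<dots> = (\<Sum>i\<in>I. \<Sum>j\<in>I. \<alpha> i * T i j * t j / (d i * d j))"
    by (simp add: sum_distrib_left sum_divide_distrib mult_ac)
  finally show ?thesis by (simp add: t_def)
qed

text \<open>After multiplication by all denominators the equation becomes an identity of polynomials in \<open>r\<close>, valid
on an infinite set and therefore everywhere. At \<open>r = \<tau>\<close> the factor \<open>\<tau>\<^sup>2 - r\<^sup>2\<close> makes one side vanish,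
while the other side is the square of a product of linear factors that are non-zero at \<open>\<tau>\<close>.\<close>
lemma inverse_quadratic_not_sum_of_simple_fractions:
  fixes A B :: "'a \<Rightarrow> real"
  assumes fin: "finite I" and inf: "infinite U" and nz: "\<And>i. i \<in> I \<Longrightarrow> A i + B i * \<tau> \<noteq> 0"
    and U: "\<And>r i. r \<in> U \<Longrightarrow> i \<in> I \<Longrightarrow> A i + B i * r \<noteq> 0" "\<And>r. r \<in> U \<Longrightarrow> r\<^sup>2 \<noteq> \<tau>\<^sup>2"
    and eq: "\<And>r. r \<in> U \<Longrightarrow>
      1 / (\<tau>\<^sup>2 - r\<^sup>2) = (\<Sum>i\<in>I. \<Sum>j\<in>I. c i j / ((A i + B i * r) * (A j + B j * r)))"
  shows False
proof -
  define D where "D = (\<Prod>k\<in>I. [:A k, B k:])"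
  define E where "E = (\<lambda>i. \<Prod>k\<in>I-{i}. [:A k, B k:])"
  define P where "P = D * D - [:\<tau>\<^sup>2, 0, - 1:] * (\<Sum>i\<in>I. \<Sum>j\<in>I. Polynomial.smult (c i j) (E i * E j))"
  have DE: "poly D r = (A i + B i * r) * poly (E i) r" if "i \<in> I" for i r
    unfolding D_def E_def by (subst prod.remove[OF fin that]) (simp add: algebra_simps)
  have "poly P r = 0" if r: "r \<in> U" for r
  proof -
    have "c i j * (poly (E i) r * poly (E j) r) =
        (poly D r)\<^sup>2 * (c i j / ((A i + B i * r) * (A j + B j * r)))" if "i \<in> I" "j \<in> I" for i j
    proof -
      have "(poly D r)\<^sup>2 = ((A i + B i * r) * poly (E i) r) * ((A j + B j * r) * poly (E j) r)"
        using DE[OF that(1), of r] DE[OF that(2), of r] by (simp add: power2_eq_square)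
      then show ?thesis using U(1)[OF r that(1)] U(1)[OF r that(2)] by simp
    qed
    then have sum: "(\<Sum>i\<in>I. \<Sum>j\<in>I. c i j * (poly (E i) r * poly (E j) r)) = (poly D r)\<^sup>2 * (1 / (\<tau>\<^sup>2 - r\<^sup>2))"
      unfolding eq[OF r] sum_distrib_left by (intro sum.cong refl)
    have "poly P r = (poly D r)\<^sup>2 - (\<tau>\<^sup>2 - r\<^sup>2) * (\<Sum>i\<in>I. \<Sum>j\<in>I. c i j * (poly (E i) r * poly (E j) r))"
      by (simp add: P_def poly_sum power2_eq_square left_diff_distrib)
    also have "\<dots> = (poly D r)\<^sup>2 - (\<tau>\<^sup>2 - r\<^sup>2) * ((poly D r)\<^sup>2 * (1 / (\<tau>\<^sup>2 - r\<^sup>2)))"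
      unfolding sum ..
    finally show ?thesis using U(2)[OF r] by simp
  qed
  then have "U \<subseteq> {r. poly P r = 0}" by auto
  then have "P = 0" using inf poly_roots_finite[of P] finite_subset by blast
  then have "poly P \<tau> = 0" by simp
  then have "poly D \<tau> = 0" by (simp add: P_def power2_eq_square)
  moreover have "poly D \<tau> \<noteq> 0" using nz fin by (simp add: D_def poly_prod mult.commute)
  ultimately show False by simp
qed

text \<open>The second order term of the transform along the ray through \<open>(a, b, c)\<close> is \<open>1 / (a b + a c + b c)\<close>. A
reward representation would make it a finite sum of fractions whose poles lie on the planes
\<open>k1 i a + k2 i b + k3 i c = 0\<close>, but the cone \<open>a b + a c + b c = 0\<close> is curved and is not covered by finitely
many planes. The points \<open>(1 - \<tau>, \<tau>\<^sup>2 - \<tau>, \<tau>)\<close> lie on this cone, and such a point outside all the planes is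
reached from the positive orthant along the line \<open>(1 - r, \<tau>\<^sup>2 - r, r)\<close>, on which
\<open>a b + a c + b c = \<tau>\<^sup>2 - r\<^sup>2\<close>.\<close>
lemma quadric_transform_no_reward_rep:
  fixes k1 k2 k3 :: "'a \<Rightarrow> real"
  assumes fin: "finite I"
    and k: "\<And>i. i \<in> I \<Longrightarrow> 0 \<le> k1 i" "\<And>i. i \<in> I \<Longrightarrow> 0 \<le> k2 i" "\<And>i. i \<in> I \<Longrightarrow> 0 \<le> k3 i"
  shows "\<not> reward_rep I \<alpha> T {(a, b, c). 0 \<le> a \<and> 0 \<le> b \<and> 0 \<le> c}
    (\<lambda>(a, b, c) i. k1 i * a + k2 i * b + k3 i * c)
    (\<lambda>(a, b, c). 1 / ((1 + a + c) * (1 + b + c) - c\<^sup>2))"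
    (is "\<not> reward_rep I \<alpha> T ?S ?v ?L")
proof
  assume "reward_rep I \<alpha> T ?S ?v ?L"
  from reward_rep_eliminate_all[OF fin this] obtain \<alpha>' T' where
    rep: "reward_rep {i\<in>I. \<exists>s\<in>?S. ?v s i \<noteq> 0} \<alpha>' T' ?S ?v ?L" by (elim exE) (rule that)
  define J where "J = {i\<in>I. \<exists>s\<in>?S. ?v s i \<noteq> 0}"
  have finJ: "finite J" using fin by (simp add: J_def)
  note rep = rep[folded J_def]
  have T': "transient_on J T'" using rep unfolding reward_rep_def by blast
  have sol: "\<exists>x. discount_eq J T' (?v s) x \<and> ?L s = 1 - sum \<alpha>' J + (\<Sum>i\<in>J. \<alpha>' i * x i)" if "s \<in> ?S" for s
    using rep that unfolding reward_rep_def by blast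
  have kJ: "0 \<le> k1 i" "0 \<le> k2 i" "0 \<le> k3 i" "k1 i \<noteq> 0 \<or> k2 i \<noteq> 0 \<or> k3 i \<noteq> 0" if "i \<in> J" for i
    using that k by (auto simp: J_def)
  let ?Z = "\<lambda>i. {\<tau>. poly [:k1 i, k3 i - k1 i - k2 i, k2 i:] \<tau> = 0}"
  have "finite (\<Union>i\<in>J. ?Z i)"
    using finJ
  proof (rule finite_UN_I)
    fix i assume "i \<in> J"
    then have "[:k1 i, k3 i - k1 i - k2 i, k2 i:] \<noteq> 0" using kJ(4)[of i] by auto
    then show "finite (?Z i)" by (rule poly_roots_finite)
  qed
  then have "infinite ({0<..} - (\<Union>i\<in>J. ?Z i))" by (simp add: infinite_Ioi)
  \<comment> \<open>The polynomial for \<open>i\<close> is the linear form of state \<open>i\<close> on the curve \<open>(1 - \<tau>, \<tau>\<^sup>2 - \<tau>, \<tau>)\<close>.\<close>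
  then have "\<exists>\<tau>. \<tau> \<in> {0<..} - (\<Union>i\<in>J. ?Z i)"
    unfolding ex_in_conv by (rule infinite_imp_nonempty)
  then obtain \<tau> where "\<tau> \<in> {0<..} - (\<Union>i\<in>J. ?Z i)" ..
  then have \<tau>: "0 < \<tau>" "\<And>i. i \<in> J \<Longrightarrow> poly [:k1 i, k3 i - k1 i - k2 i, k2 i:] \<tau> \<noteq> 0"
    by simp_all
  define A where "A = (\<lambda>i. k1 i + k2 i * \<tau>\<^sup>2)"
  define B where "B = (\<lambda>i. k3 i - k1 i - k2 i)"
  \<comment> \<open>For \<open>r\<close> in this interval the point \<open>(1 - r, \<tau>\<^sup>2 - r, r)\<close> lies in the open orthant.\<close>
  let ?U = "{0<..<min 1 (\<tau>\<^sup>2)}"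
  have d: "A i + B i * r = k1 i * (1 - r) + k2 i * (\<tau>\<^sup>2 - r) + k3 i * r" for i r
    by (simp add: A_def B_def algebra_simps)
  have dpos: "0 < A i + B i * r" if "r \<in> ?U" "i \<in> J" for r i
  proof -
    have "0 \<le> k1 i * (1 - r)" "0 \<le> k2 i * (\<tau>\<^sup>2 - r)" "0 \<le> k3 i * r"
      using kJ[OF that(2)] that(1) by auto
    moreover have "k1 i * (1 - r) \<noteq> 0 \<or> k2 i * (\<tau>\<^sup>2 - r) \<noteq> 0 \<or> k3 i * r \<noteq> 0"
      using kJ(4)[OF that(2)] that(1) by auto
    ultimately show ?thesis unfolding d by linarith
  qed
  have r2: "r\<^sup>2 < \<tau>\<^sup>2" if "r \<in> ?U" for r
  proof -
    have "r * r < 1 * \<tau>\<^sup>2" using that by (intro mult_strict_mono) auto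
    then show ?thesis by (simp add: power2_eq_square)
  qed
  show False
  proof (rule inverse_quadratic_not_sum_of_simple_fractions[OF finJ, of ?U A B \<tau>
        "\<lambda>i j. \<alpha>' i * T' i j * - (\<Sum>k\<in>J. T' j k)"])
    show "infinite ?U" using \<tau>(1) by (intro infinite_Ioo) auto
    show "A i + B i * \<tau> \<noteq> 0" if "i \<in> J" for i
      using \<tau>(2)[OF that] by (simp add: A_def B_def algebra_simps power2_eq_square)
    show "A i + B i * r \<noteq> 0" if "r \<in> ?U" "i \<in> J" for i r using dpos[OF that] by simp
    show "r\<^sup>2 \<noteq> \<tau>\<^sup>2" if "r \<in> ?U" for r using r2[OF that] by simp
    fix r assume r: "r \<in> ?U"
    let ?s = "\<lambda>u. (u * (1 - r), u * (\<tau>\<^sup>2 - r), u * r)"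
    have v: "?v (?s u) = (\<lambda>i. u * (A i + B i * r))" for u
      unfolding d by (auto simp: algebra_simps)
    let ?sol = "\<lambda>u x. discount_eq J T' (\<lambda>i. u * (A i + B i * r)) x \<and>
        ?L (?s u) = 1 - sum \<alpha>' J + (\<Sum>i\<in>J. \<alpha>' i * x i)"
    have "\<forall>u. \<exists>x. 0 < u \<longrightarrow> ?sol u x"
    proof
      fix u :: real
      have "\<exists>x. ?sol u x" if "0 < u"
      proof -
        have "?s u \<in> ?S" using r that by auto
        from sol[OF this] show ?thesis unfolding v .
      qed
      then show "\<exists>x. 0 < u \<longrightarrow> ?sol u x" by (cases "0 < u") auto
    qed
    from choice[OF this] obtain X where "\<forall>u. 0 < u \<longrightarrow> ?sol u (X u)" ..
    then have X: "\<And>u. 0 < u \<Longrightarrow> discount_eq J T' (\<lambda>i. u * (A i + B i * r)) (X u)"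
      "\<And>u. 0 < u \<Longrightarrow> ?L (?s u) = 1 - sum \<alpha>' J + (\<Sum>i\<in>J. \<alpha>' i * X u i)"
      by simp_all
    have inv: "((\<lambda>u::real. 1 / u) \<longlongrightarrow> 0) at_top"
      by (rule tendsto_divide_0[OF tendsto_const]) (rule filterlim_at_top_imp_at_infinity[OF filterlim_ident])
    have "((\<lambda>u::real. 1 / ((1 / u + 1) * (1 / u + \<tau>\<^sup>2) - r\<^sup>2)) \<longlongrightarrow> 1 / ((0 + 1) * (0 + \<tau>\<^sup>2) - r\<^sup>2)) at_top"
      by (intro tendsto_intros inv) (use r2[OF r] in auto)
    then have "((\<lambda>u::real. 1 / ((1 / u + 1) * (1 / u + \<tau>\<^sup>2) - r\<^sup>2)) \<longlongrightarrow> 1 / (\<tau>\<^sup>2 - r\<^sup>2)) at_top" by simp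
    then have lim: "((\<lambda>u. u\<^sup>2 * ?L (?s u)) \<longlongrightarrow> 1 / (\<tau>\<^sup>2 - r\<^sup>2)) at_top"
    proof (rule Lim_transform_eventually)
      show "\<forall>\<^sub>F u in at_top. 1 / ((1 / u + 1) * (1 / u + \<tau>\<^sup>2) - r\<^sup>2) = u\<^sup>2 * ?L (?s u)"
        using eventually_gt_at_top[of 0]
      proof eventually_elim
        case (elim u)
        have factors: "1 + u * (1 - r) + u * r = u * (1 / u + 1)" "1 + u * (\<tau>\<^sup>2 - r) + u * r = u * (1 / u + \<tau>\<^sup>2)"
          using elim by (simp_all add: right_diff_distrib distrib_left)
        have "(u * a) * (u * b) - (u * r)\<^sup>2 = u\<^sup>2 * (a * b - r\<^sup>2)" for a b
          by (simp add: power2_eq_square right_diff_distrib)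
        then show ?case using elim by (simp add: factors)
      qed
    qed
    show "1 / (\<tau>\<^sup>2 - r\<^sup>2) = (\<Sum>i\<in>J. \<Sum>j\<in>J. \<alpha>' i * T' i j * - (\<Sum>k\<in>J. T' j k) /
        ((A i + B i * r) * (A j + B j * r)))"
      by (rule reward_transform_second_order[OF finJ T' dpos[OF r] X lim])
  qed
qed

section \<open>The inclusion is strict\<close>

text \<open>Three distinct coordinates carry the law with transform \<open>1 / det (I + M(s))\<close>, where \<open>M(s)\<close> is a
\<open>2 \<times> 2\<close> matrix depending linearly on \<open>s\<close>. For \<open>a \<ge> 0\<close> the matrix \<open>M(a)\<close> is positive semidefinite, so the
projection to \<open>a\<close> is a sum of two independent exponential variables whose means are the
eigenvalues, possibly \<open>0\<close>.
For the negative part the other coordinates of \<open>s\<close> are set to \<open>0\<close>.\<close>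
lemma exists_MVPH_not_MPH_star:
  assumes n: "CARD('n::finite) \<ge> 3"
  shows "\<exists>\<mu> :: (real ^ 'n) measure. \<mu> \<in> MVPH \<and> \<mu> \<notin> MPH_star"
proof -
  obtain S :: "'n set" where "card S = 3"
    using obtain_subset_with_card_n[OF n] by blast
  then obtain i1 i2 i3 :: 'n where dist: "i1 \<noteq> i2" "i1 \<noteq> i3" "i2 \<noteq> i3"
    by (auto simp: card_3_iff)
  obtain \<mu> :: "(real ^ 'n) measure" where
    \<mu>: "prob_space \<mu>" "sets \<mu> = sets borel" "AE x in \<mu>. x \<in> nonneg_orthant"
    and L: "\<And>s. s \<in> nonneg_orthant \<Longrightarrow> (\<integral>x. exp (- (s \<bullet> x)) \<partial>\<mu>) =
       1 / ((1 + s $ i1 + s $ i3) * (1 + s $ i2 + s $ i3) - (s $ i3)\<^sup>2)"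
    using exists_quadric_law[OF dist] by blast
  have "distr \<mu> borel (\<lambda>x. a \<bullet> x) \<in> PH" if a: "a \<in> nonneg_orthant - {0}" for a
  proof -
    have meas: "(\<lambda>x. a \<bullet> x) \<in> borel_measurable \<mu>"
      using \<mu>(2) by (simp cong: measurable_cong_sets)
    have a0: "0 \<le> a $ i" for i using a by (simp add: nonneg_orthant_def)
    obtain l1 l2 where l: "0 \<le> l1" "0 \<le> l2" and
      fac: "\<And>s. (1 + s * a $ i1 + s * a $ i3) * (1 + s * a $ i2 + s * a $ i3) - (s * a $ i3)\<^sup>2 =
        (1 + s * l1) * (1 + s * l2)"
      using quadric_factors[of "a $ i1" "a $ i2" "a $ i3", OF a0 a0 a0] by blast
    have "(\<integral>z. exp (- (s * z)) \<partial>distr \<mu> borel (\<lambda>x. a \<bullet> x)) = 1 / ((1 + s * l1) * (1 + s * l2))"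
      if s: "0 \<le> s" for s
    proof -
      have "s *\<^sub>R a \<in> nonneg_orthant" using s a0 by (simp add: nonneg_orthant_def)
      moreover have "(\<integral>z. exp (- (s * z)) \<partial>distr \<mu> borel (\<lambda>x. a \<bullet> x)) = (\<integral>x. exp (- ((s *\<^sub>R a) \<bullet> x)) \<partial>\<mu>)"
        using meas by (subst integral_distr) auto
      ultimately show ?thesis by (simp only: L) (simp add: fac)
    qed
    from hypoexponential_reward_rep[OF l this] show ?thesis
    proof (rule PH_of_reward_rep[rotated -1])
      show "prob_space (distr \<mu> borel (\<lambda>x. a \<bullet> x))"
        by (rule prob_space.prob_space_distr[OF \<mu>(1) meas])
      show "AE z in distr \<mu> borel (\<lambda>x. a \<bullet> x). 0 \<le> z"
        using \<mu>(3) inner_nonneg_orthant a by (subst AE_distr_iff[OF meas]) (auto elim: eventually_mono)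
    qed (use l in auto)
  qed
  then have "\<mu> \<in> MVPH" unfolding MVPH_def using \<mu> by simp
  moreover have "\<mu> \<notin> MPH_star"
  proof
    assume "\<mu> \<in> MPH_star"
    then obtain m \<alpha> T and K :: "nat \<Rightarrow> real ^ 'n" where
      \<alpha>: "subprobability_vec m \<alpha>" and T: "transient_subgenerator m T"
      and K: "\<forall>i<m. K i \<in> nonneg_orthant"
      and rep: "\<forall>s\<in>nonneg_orthant. (\<integral>x. exp (- (s \<bullet> x)) \<partial>\<mu>) =
          (1 - \<alpha> \<bullet>v ones_vec m) +
          \<alpha> \<bullet>v (mat_inv (- T + mat_diag m (\<lambda>i. K i \<bullet> s)) *\<^sub>v exit_vec m T)"
      unfolding MPH_star_def by blast
    let ?S = "{(a, b, c). 0 \<le> a \<and> 0 \<le> b \<and> 0 \<le> c} :: (real \<times> real \<times> real) set"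
    let ?v = "\<lambda>(a, b, c) i. K i $ i1 * a + K i $ i2 * b + K i $ i3 * c"
    let ?L = "\<lambda>(a, b, c). 1 / ((1 + a + c) * (1 + b + c) - c\<^sup>2)"
    have "reward_rep {..<m} (\<lambda>i. \<alpha> $v i) (\<lambda>i j. T $$ (i, j)) ?S ?v ?L"
    proof (subst reward_rep_of_matrix[OF T \<alpha>])
      show "0 \<le> ?v s i" if "s \<in> ?S" "i < m" for s i
        using that K by (auto simp: nonneg_orthant_def)
      show "\<forall>s\<in>?S. ?L s = (1 - \<alpha> \<bullet>v ones_vec m) +
          \<alpha> \<bullet>v (mat_inv (- T + mat_diag m (?v s)) *\<^sub>v exit_vec m T)"
      proof
        fix s assume "s \<in> ?S"
        then obtain a b c where s: "s = (a, b, c)" "0 \<le> a" "0 \<le> b" "0 \<le> c" by auto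
        define e where "e = a *\<^sub>R axis i1 1 + b *\<^sub>R axis i2 1 + c *\<^sub>R (axis i3 1 :: real ^ 'n)"
        have e: "e $ i1 = a" "e $ i2 = b" "e $ i3 = c" and e0: "e \<in> nonneg_orthant"
          using dist s by (auto simp: e_def axis_def nonneg_orthant_def)
        have "K i \<bullet> e = ?v s i" for i
          by (simp add: e_def s(1) inner_add_right inner_axis)
        then show "?L s = (1 - \<alpha> \<bullet>v ones_vec m) +
          \<alpha> \<bullet>v (mat_inv (- T + mat_diag m (?v s)) *\<^sub>v exit_vec m T)"
          using bspec[OF rep e0] L[OF e0] by (simp add: s(1) e)
      qed
    qed
    then show False
      using quadric_transform_no_reward_rep[of "{..<m}" "\<lambda>i. K i $ i1" "\<lambda>i. K i $ i2" "\<lambda>i. K i $ i3"] K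
      by (auto simp: nonneg_orthant_def)
  qed
  ultimately show ?thesis by blast
qed

theorem corollary4p7:
  assumes "CARD('n::finite) \<ge> 3"
  shows "(MPH_star :: (real ^ 'n) measure set) \<subset> MVPH"
  using MPH_star_subset_MVPH exists_MVPH_not_MPH_star[OF assms] by blast

end
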